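(* Let $n\ge 4$, let $\lambda_3,\dots,\lambda_{n-1}\in\mathbb{R}$, $\alpha\le 0$ and $\beta>0$, and let $g_{\mathbb{R}^n}$ be the Lorentzian metric on $\mathbb{R}^n$ given by $$g_{\mathbb{R}^n} = e^{-2\alpha x_{n}}\left[\cos(2\beta x_{n})(-dx_{1}^{2} + dx_{2}^{2}) - 2\sin(2\beta x_{n})\,dx_{1} dx_{2}\right] + \sum_{i = 3}^{n-1} e^{-2\lambda_{i} x_{n}} dx_{i}^{2} + dx_{n}^{2},$$ where $x_1,\dots,x_n$ are the canonical coordinates. Then the homogeneous Lorentzian manifold $(\mathbb{R}^n,g_{\mathbb{R}^n})$ is geodesically complete.
   Context: Geodesically complete means that every geodesic can be extended to a geodesic defined for all real values of its affine parameter. No Ricci-flatness or further relation among the parameters is assumed. *)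

theory Defs
  imports "HOL-Analysis.Analysis"
begin

section \<open>Pseudo-Riemannian geometry on \<open>\<real>\<^sup>n\<close> in its global chart\<close>

text \<open>
  The manifold \<open>\<real>\<^sup>n\<close> is the type \<open>real ^ 'n\<close>, and every tangent space is identified with the
  same type through the canonical coordinates. A metric \<open>g\<close> assigns to each point \<open>p\<close> a form \<open>g p\<close>
  on the tangent space at \<open>p\<close>.
\<close>

type_synonym 'n metric = "real ^ 'n \<Rightarrow> real ^ 'n \<Rightarrow> real ^ 'n \<Rightarrow> real"

definition partial_deriv :: "'n::finite \<Rightarrow> (real ^ 'n \<Rightarrow> real) \<Rightarrow> real ^ 'n \<Rightarrow> real" where
  "partial_deriv i f p = frechet_derivative f (at p) (axis i 1)"

primrec Ck :: "nat \<Rightarrow> (real ^ 'n::finite \<Rightarrow> real) \<Rightarrow> bool" where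
  "Ck 0 f \<longleftrightarrow> continuous_on UNIV f"
| "Ck (Suc k) f \<longleftrightarrow> (\<forall>p. f differentiable (at p)) \<and> (\<forall>i. Ck k (partial_deriv i f))"

definition smooth :: "(real ^ 'n::finite \<Rightarrow> real) \<Rightarrow> bool" where
  "smooth f \<longleftrightarrow> (\<forall>k. Ck k f)"

definition metric_coeff :: "'n::finite metric \<Rightarrow> 'n \<Rightarrow> 'n \<Rightarrow> real ^ 'n \<Rightarrow> real" where
  "metric_coeff g i j p = g p (axis i 1) (axis j 1)"

text \<open>
  Signature \<open>(-, +, \<dots>, +)\<close> is expressed by an orthonormal frame at each point with exactly one
  timelike vector; such a family is automatically a basis, so nondegeneracy is included.
\<close>

definition lorentzian_metric :: "'n::finite metric \<Rightarrow> bool" where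
  "lorentzian_metric g \<longleftrightarrow>
     (\<forall>i j. smooth (metric_coeff g i j)) \<and>
     (\<forall>p. bilinear (g p) \<and> (\<forall>v w. g p v w = g p w v) \<and>
       (\<exists>(b :: 'n \<Rightarrow> real ^ 'n) k. \<forall>i j.
          g p (b i) (b j) = (if i \<noteq> j then 0 else if i = k then -1 else 1)))"

definition diffeomorphism :: "(real ^ 'n::finite \<Rightarrow> real ^ 'n) \<Rightarrow> bool" where
  "diffeomorphism \<phi> \<longleftrightarrow>
     bij \<phi> \<and> (\<forall>i. smooth (\<lambda>p. \<phi> p $ i)) \<and> (\<forall>i. smooth (\<lambda>p. inv \<phi> p $ i))"

definition isometry :: "'n::finite metric \<Rightarrow> (real ^ 'n \<Rightarrow> real ^ 'n) \<Rightarrow> bool" where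
  "isometry g \<phi> \<longleftrightarrow> diffeomorphism \<phi> \<and>
     (\<forall>p v w. g (\<phi> p) (frechet_derivative \<phi> (at p) v) (frechet_derivative \<phi> (at p) w) = g p v w)"

definition homogeneous :: "'n::finite metric \<Rightarrow> bool" where
  "homogeneous g \<longleftrightarrow> (\<forall>p q. \<exists>\<phi>. isometry g \<phi> \<and> \<phi> p = q)"

text \<open>Christoffel symbols \<open>\<Gamma>\<^sup>k\<^sub>i\<^sub>j\<close> of the Levi-Civita connection.\<close>

definition christoffel :: "'n::finite metric \<Rightarrow> 'n \<Rightarrow> 'n \<Rightarrow> 'n \<Rightarrow> real ^ 'n \<Rightarrow> real" where
  "christoffel g k i j p =
     (1 / 2) * (\<Sum>l\<in>UNIV. matrix_inv (\<chi> a b. metric_coeff g a b p) $ k $ l *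
        (partial_deriv i (metric_coeff g j l) p
         + partial_deriv j (metric_coeff g i l) p
         - partial_deriv l (metric_coeff g i j) p))"

text \<open>The domain \<open>I\<close> is meant to be an open interval, possibly unbounded.\<close>

definition geodesic_on :: "'n::finite metric \<Rightarrow> real set \<Rightarrow> (real \<Rightarrow> real ^ 'n) \<Rightarrow> bool" where
  "geodesic_on g I \<gamma> \<longleftrightarrow>
     (\<exists>\<gamma>' \<gamma>''. \<forall>t\<in>I.
        (\<gamma> has_vector_derivative \<gamma>' t) (at t) \<and>
        (\<gamma>' has_vector_derivative \<gamma>'' t) (at t) \<and>
        (\<forall>k. \<gamma>'' t $ k
            + (\<Sum>i\<in>UNIV. \<Sum>j\<in>UNIV. christoffel g k i j (\<gamma> t) * (\<gamma>' t $ i) * (\<gamma>' t $ j)) = 0))"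

definition geodesically_complete :: "'n::finite metric \<Rightarrow> bool" where
  "geodesically_complete g \<longleftrightarrow>
     (\<forall>I \<gamma>. open I \<and> is_interval I \<and> I \<noteq> {} \<and> geodesic_on g I \<gamma> \<longrightarrow>
        (\<exists>\<delta>. geodesic_on g UNIV \<delta> \<and> (\<forall>t\<in>I. \<delta> t = \<gamma> t)))"

section \<open>The metric\<close>

text \<open>
  The bijection \<open>e\<close> from \<open>{1..n}\<close> onto the index type, \<open>n = CARD('n)\<close>, numbers the canonical
  coordinates: \<open>x\<^sub>i\<close> is \<open>x $ e i\<close>, and \<open>dx\<^sub>i\<close> applied to a vector \<open>v\<close> is \<open>v $ e i\<close>.
  In the bilinear form, \<open>2 dx\<^sub>1 dx\<^sub>2\<close> is the symmetric product
  \<open>dx\<^sub>1 \<otimes> dx\<^sub>2 + dx\<^sub>2 \<otimes> dx\<^sub>1\<close>. Only the values of \<open>lam\<close> on \<open>{3..n-1}\<close> matter.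
\<close>

definition g_Rn ::
  "(nat \<Rightarrow> 'n::finite) \<Rightarrow> (nat \<Rightarrow> real) \<Rightarrow> real \<Rightarrow> real \<Rightarrow> 'n metric" where
  "g_Rn e lam \<alpha> \<beta> x v w =
     (let n = CARD('n); xn = x $ e n in
       exp (- 2 * \<alpha> * xn) *
         (cos (2 * \<beta> * xn) * (- (v $ e 1 * w $ e 1) + v $ e 2 * w $ e 2)
          - sin (2 * \<beta> * xn) * (v $ e 1 * w $ e 2 + v $ e 2 * w $ e 1))
       + (\<Sum>i\<in>{3..n-1}. exp (- 2 * lam i * xn) * (v $ e i * w $ e i))
       + v $ e n * w $ e n)"

end

theory Submission
  imports Defs
begin

text \<open>
  The metric depends on \<open>x\<^sub>n\<close> only, so along a geodesic the momenta \<open>p\<^sub>i\<close>, \<open>i < n\<close>, are constant,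
  and \<open>s = x\<^sub>n\<close> moves in the potential
  \<open>V(s) = e\<^bsup>2\<alpha>s\<^esup> (A cos 2\<beta>s + B sin 2\<beta>s) + \<Sum> p\<^sub>i\<^sup>2 e\<^bsup>2\<lambda>\<^sub>is\<^esup>\<close> with \<open>A = p\<^sub>2\<^sup>2 - p\<^sub>1\<^sup>2\<close>, \<open>B = -2p\<^sub>1p\<^sub>2\<close>:
  the energy \<open>s'\<^sup>2 + V(s)\<close> is conserved. As \<open>\<alpha> \<le> 0\<close>, the oscillating term is bounded for
  \<open>s \<rightarrow> \<infinity>\<close>, and for \<open>s \<rightarrow> -\<infinity>\<close> it either is bounded or
  reaches arbitrarily high positive values. Hence on each side \<open>s\<close> is stopped by a potential
  barrier unless \<open>V''\<close> is bounded there, and in both cases the equation of motion has a global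
  solution. The other coordinates are then integrals of known functions.
\<close>

section \<open>Ordinary differential equations\<close>

text \<open>Antiderivatives on the whole line with values in a Banach space; they serve the Picard
  map, the energy of a retracted force, and the recovery of a curve from its velocity.\<close>

lemma continuous_has_antiderivative:
  fixes g :: "real \<Rightarrow> 'a::banach"
  assumes "continuous_on UNIV g"
  obtains G where "G t0 = x0" "\<And>t. (G has_vector_derivative g t) (at t)"
proof -
  \<comment> \<open>The signed integral from 0. On each window \<open>{-n<..<n}\<close> it differs
    by a constant from the integral starting at \<open>-n\<close>, to which the fundamental theorem
    applies.\<close>
  define H where "H t = (if 0 \<le> t then integral {0..t} g else - integral {t..0} g)" for t
  have int: "g integrable_on {a..b}" for a b
    using assms by (intro integrable_continuous_interval) (auto intro: continuous_on_subset)
  have H: "(H has_vector_derivative g t) (at t)" for t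
  proof -
    define n where "n = \<bar>t\<bar> + 1"
    have "H u = integral {-n..u} g - integral {-n..0} g" if "u \<in> {-n<..<n}" for u
    proof (cases "0 \<le> u")
      case True
      then show ?thesis
        using Henstock_Kurzweil_Integration.integral_combine[of "-n" 0 u g] int by (simp add: H_def n_def algebra_simps)
    next
      case False
      then show ?thesis
        using Henstock_Kurzweil_Integration.integral_combine[of "-n" u 0 g] int that by (simp add: H_def algebra_simps)
    qed
    moreover have "((\<lambda>u. integral {-n..u} g) has_vector_derivative g t) (at t within {-n..n})"
      by (rule integral_has_vector_derivative)
        (use assms in \<open>auto simp: n_def intro: continuous_on_subset\<close>)
    then have "((\<lambda>u. integral {-n..u} g) has_vector_derivative g t) (at t)"
      by (subst (asm) at_within_Icc_at) (auto simp: n_def)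
    then have "((\<lambda>u. integral {-n..u} g - integral {-n..0} g) has_vector_derivative g t) (at t)"
      by (auto intro!: derivative_eq_intros)
    ultimately show ?thesis
      by (elim has_vector_derivative_transform_within_open[where S = "{-n<..<n}"]) (auto simp: n_def)
  qed
  show thesis
    by (rule that[of "\<lambda>t. H t - H t0 + x0"]) (auto intro!: derivative_eq_intros H)
qed

text \<open>For \<open>t > 0\<close> the bound on \<open>g\<close> is the derivative of
  \<open>M / c * exp (c * t)\<close>, which is nonnegative at 0; negative times follow by
  reflection. The gain of the factor \<open>1 / c\<close> is what makes the weighted Picard map
  contract.\<close>

lemma antiderivative_exp_bound:
  fixes G :: "real \<Rightarrow> 'a::real_normed_vector"
  assumes G: "\<And>t. (G has_vector_derivative g t) (at t)" and "G 0 = 0"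
    and g: "\<And>t. norm (g t) \<le> M * exp (c * \<bar>t\<bar>)" and "c > 0"
  shows "norm (G t) \<le> M / c * exp (c * \<bar>t\<bar>)"
proof -
  have M: "M \<ge> 0" using order_trans[OF norm_ge_zero g[of 0]] by simp
  have *: "norm (G t) \<le> M / c * exp (c * t)"
    if "t > 0" and G: "\<And>t. (G has_vector_derivative g t) (at t)" and "G 0 = 0"
      and g: "\<And>t. norm (g t) \<le> M * exp (c * \<bar>t\<bar>)" for t G g
  proof -
    have "norm (G t - G 0) \<le> M / c * exp (c * t) - M / c * exp (c * 0)"
    proof (rule differentiable_bound_general)
      show "continuous_on {0..t} G"
        using G by (intro continuous_at_imp_continuous_on ballI has_vector_derivative_continuous)
      show "((\<lambda>t. M / c * exp (c * t)) has_vector_derivative M * exp (c * t)) (at t)" for t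
        unfolding has_real_derivative_iff_has_vector_derivative[symmetric]
        using \<open>c > 0\<close> by (auto intro!: derivative_eq_intros)
      show "norm (g x) \<le> M * exp (c * x)" if "0 < x" for x
        using g[of x] that by simp
    qed (use \<open>t > 0\<close> \<open>c > 0\<close> G in \<open>auto intro!: continuous_intros\<close>)
    moreover have "M / c \<ge> 0" using M \<open>c > 0\<close> by simp
    ultimately show ?thesis using \<open>G 0 = 0\<close> by simp
  qed
  consider "t > 0" | "t = 0" | "t < 0" by linarith
  then show ?thesis
  proof cases
    case 1
    then show ?thesis using *[OF 1 assms(1-3)] by simp
  next
    case 2
    then show ?thesis using M assms by simp
  next
    case 3
    have "norm ((\<lambda>t. G (- t)) (- t)) \<le> M / c * exp (c * - t)"
    proof (rule *)
      show "((\<lambda>t. G (- t)) has_vector_derivative - g (- t)) (at t)" for t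
        using vector_diff_chain_at[OF has_vector_derivative_minus[OF has_vector_derivative_id] G, of t]
        by (simp add: o_def)
      show "norm (- g (- t)) \<le> M * exp (c * \<bar>t\<bar>)" for t
        using g[of "- t"] by simp
    qed (use 3 assms in auto)
    then show ?thesis using 3 by simp
  qed
qed

lemma lipschitz_ode_global_solution:
  fixes f :: "'a::banach \<Rightarrow> 'a"
  assumes f: "L-lipschitz_on UNIV f"
  obtains x where "x t0 = x0" "\<And>t. (x has_vector_derivative f (x t)) (at t)"
proof -
  have L: "L \<ge> 0" using f by (rule lipschitz_on_nonneg)
  \<comment> \<open>Any weight exponent above \<open>L\<close> gives the ratio
    \<open>L / c < 1\<close>; adding 1 also keeps \<open>c\<close> positive when
    \<open>L = 0\<close>.\<close>
  define c where "c = L + 1"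
  have c: "c > 0" "L / c < 1" "L / c \<ge> 0" using L by (auto simp: c_def)
  \<comment> \<open>Writing \<open>x t = x0 + w t *\<^sub>R y t\<close> with bounded \<open>y\<close>, the weight \<open>w\<close> makes the Picard map a
    contraction on the whole line.\<close>
  define w where "w t = exp (c * \<bar>t\<bar>)" for t
  have w: "w t > 0" "w t \<ge> 1" for t using c by (auto simp: w_def)
  have wc: "continuous_on UNIV w" by (auto simp: w_def intro!: continuous_intros)
  define g where "g y t = f (x0 + w t *\<^sub>R apply_bcontfun y t)" for y t
  have fc: "continuous_on UNIV f" using f by (rule lipschitz_on_continuous_on)
  have gc: "continuous_on UNIV (g y)" for y
    unfolding g_def by (intro continuous_on_compose2[OF fc] continuous_intros wc) auto
  have "\<forall>y. \<exists>G. G 0 = 0 \<and> (\<forall>t. (G has_vector_derivative g y t) (at t))"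
    using continuous_has_antiderivative[OF gc] by metis
  then obtain G where G0: "\<And>y. G y 0 = 0"
    and G: "\<And>y t. (G y has_vector_derivative g y t) (at t)" by metis
  define P where "P y t = (1 / w t) *\<^sub>R G y t" for y t
  have P: "P y \<in> bcontfun" for y
  proof (rule bcontfun_normI)
    have "continuous_on UNIV (G y)"
      using G by (intro continuous_at_imp_continuous_on ballI has_vector_derivative_continuous)
    then show "continuous_on UNIV (P y)"
      unfolding P_def by (intro continuous_intros wc) (auto simp: w_def)
    fix t
    have "norm (g y t) \<le> (norm (f x0) + L * norm y) * exp (c * \<bar>t\<bar>)" for t
    proof -
      have "norm (g y t) \<le> norm (f x0) + norm (g y t - f x0)"
        using norm_triangle_sub by blast
      also have "norm (g y t - f x0) \<le> L * (w t * norm (apply_bcontfun y t))"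
        using lipschitz_onD[OF f, of "x0 + w t *\<^sub>R apply_bcontfun y t" x0] w(1)[of t]
        by (simp add: g_def dist_norm)
      also have "\<dots> \<le> L * (w t * norm y)"
        using L w(1)[of t] norm_bounded[of y t] by (intro mult_left_mono) auto
      also have "norm (f x0) \<le> norm (f x0) * w t"
        using w(2)[of t] by (simp add: mult_le_cancel_left1)
      finally show ?thesis by (simp add: w_def algebra_simps)
    qed
    from antiderivative_exp_bound[OF G G0 this c(1), of t] w(1)[of t]
    show "norm (P y t) \<le> (norm (f x0) + L * norm y) / c"
      by (simp add: P_def w_def field_simps)
  qed
  have "\<exists>!y. Bcontfun (P y) = y"
  proof (rule banach_fix_type[OF c(3,2)], intro allI)
    fix y z
    show "dist (Bcontfun (P y)) (Bcontfun (P z)) \<le> L / c * dist y z"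
    proof (rule dist_bound)
      fix t
      have D: "((\<lambda>t. G y t - G z t) has_vector_derivative g y t - g z t) (at t)" for t
        by (intro derivative_intros G)
      have "norm (g y t - g z t) \<le> (L * dist y z) * exp (c * \<bar>t\<bar>)" for t
      proof -
        have "norm (g y t - g z t) \<le> L * (w t * dist (apply_bcontfun y t) (apply_bcontfun z t))"
          using lipschitz_onD[OF f, of "x0 + w t *\<^sub>R apply_bcontfun y t" "x0 + w t *\<^sub>R apply_bcontfun z t"]
            w(1)[of t] by (simp add: g_def dist_norm flip: scaleR_diff_right)
        also have "\<dots> \<le> L * (w t * dist y z)"
          using L w(1)[of t] dist_bounded[of y t z] by (intro mult_left_mono) auto
        finally show ?thesis by (simp add: w_def algebra_simps)
      qed
      from antiderivative_exp_bound[OF D _ this c(1), of t]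
      have "norm (G y t - G z t) \<le> L * dist y z / c * w t"
        by (simp add: G0 w_def)
      moreover have "norm (P y t - P z t) = norm (G y t - G z t) / w t"
        using w(1)[of t] by (simp add: P_def flip: scaleR_diff_right)
      ultimately have "norm (P y t - P z t) \<le> L * dist y z / c"
        using w(1)[of t] by (simp add: pos_divide_le_eq)
      then show "dist (apply_bcontfun (Bcontfun (P y)) t) (apply_bcontfun (Bcontfun (P z)) t)
          \<le> L / c * dist y z"
        by (simp only: Bcontfun_inverse P dist_norm) simp
    qed
  qed
  then obtain y where "Bcontfun (P y) = y" by blast
  then have y: "apply_bcontfun y = P y" using P Bcontfun_inverse by metis
  \<comment> \<open>At the fixed point the weight cancels: \<open>w t *\<^sub>R y t\<close> is
    \<open>G y t\<close>, so \<open>x0 + G y t\<close> solves the equation with value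
    \<open>x0\<close> at time 0. As \<open>f\<close> does not depend on time, shifting by
    \<open>t0\<close> moves the initial time.\<close>
  have "g y t = f (x0 + G y t)" for t
    using w(1)[of t] by (simp add: g_def y) (simp add: P_def)
  then have "((\<lambda>t. x0 + G y (t - t0)) has_vector_derivative f (x0 + G y (t - t0))) (at t)" for t
    using vector_diff_chain_at[OF has_vector_derivative_diff[OF has_vector_derivative_id
          has_vector_derivative_const] G, of y t0 t]
    by (auto simp: o_def intro!: derivative_eq_intros)
  with that[of "\<lambda>t. x0 + G y (t - t0)"] show thesis by (simp add: G0)
qed

text \<open>A Gronwall argument for the squared distance \<open>u\<close> of the two solutions in
  phase space. Both stay in a compact ball over the segment from \<open>t0\<close> to
  \<open>t\<close>, so a bound \<open>B\<close> of \<open>F1\<close> there is enough for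
  \<open>\<bar>u'\<bar> \<le> (1 + B) * u\<close>; the force may fail to be globally
  Lipschitz.\<close>

lemma second_order_ode_unique:
  fixes F F1 \<sigma> \<tau> v w :: "real \<Rightarrow> real"
  assumes I: "is_interval I" "t0 \<in> I" "t \<in> I"
    and \<sigma>: "\<And>t. t \<in> I \<Longrightarrow> (\<sigma> has_real_derivative v t) (at t)"
      "\<And>t. t \<in> I \<Longrightarrow> (v has_real_derivative F (\<sigma> t)) (at t)"
    and \<tau>: "\<And>t. t \<in> I \<Longrightarrow> (\<tau> has_real_derivative w t) (at t)"
      "\<And>t. t \<in> I \<Longrightarrow> (w has_real_derivative F (\<tau> t)) (at t)"
    and F: "\<And>x. (F has_real_derivative F1 x) (at x)" "continuous_on UNIV F1"
    and init: "\<sigma> t0 = \<tau> t0" "v t0 = w t0"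
  shows "\<sigma> t = \<tau> t"
proof -
  let ?S = "closed_segment t0 t"
  have S: "?S \<subseteq> I" using I by (simp add: closed_segment_subset is_interval_convex)
  have "continuous_on ?S \<sigma>" "continuous_on ?S \<tau>"
    using \<sigma>(1) \<tau>(1) S by (auto intro!: continuous_at_imp_continuous_on DERIV_isCont)
  then have "bounded (\<sigma> ` ?S \<union> \<tau> ` ?S)"
    by (intro compact_imp_bounded compact_Un compact_continuous_image) auto
  then obtain K where K: "\<And>x. x \<in> ?S \<Longrightarrow> \<sigma> x \<in> cball 0 K \<and> \<tau> x \<in> cball 0 K"
    unfolding bounded_iff by (auto simp: ball_Un)
  have "bounded (F1 ` cball 0 K)"
    using F(2) by (intro compact_imp_bounded compact_continuous_image) (auto intro: continuous_on_subset)
  then obtain B where B: "\<forall>x\<in>cball 0 K. \<bar>F1 x\<bar> \<le> B" "B > 0"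
    unfolding bounded_pos real_norm_def by blast
  define u where "u x = (\<sigma> x - \<tau> x)\<^sup>2 + (v x - w x)\<^sup>2" for x
  define u' where "u' x = 2 * (\<sigma> x - \<tau> x) * (v x - w x) + 2 * (v x - w x) * (F (\<sigma> x) - F (\<tau> x))" for x
  have u: "(u has_real_derivative u' x) (at x)" if "x \<in> ?S" for x
  proof -
    have "x \<in> I" using that S by blast
    note d = \<sigma>[OF this] \<tau>[OF this]
    show ?thesis
      unfolding u_def u'_def by (auto intro!: derivative_eq_intros d simp: algebra_simps)
  qed
  have bound: "\<bar>u' x\<bar> \<le> (1 + B) * u x" if "x \<in> ?S" for x
  proof -
    have "\<bar>F (\<sigma> x) - F (\<tau> x)\<bar> \<le> B * \<bar>\<sigma> x - \<tau> x\<bar>"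
      using field_differentiable_bound[of "cball 0 K" F F1 B "\<tau> x" "\<sigma> x"] K[OF that] B(1) F(1)
      by (auto simp: abs_minus_commute intro: has_field_derivative_at_within)
    then have "\<bar>2 * (v x - w x) * (F (\<sigma> x) - F (\<tau> x))\<bar> \<le> 2 * \<bar>v x - w x\<bar> * (B * \<bar>\<sigma> x - \<tau> x\<bar>)"
      unfolding abs_mult by (intro mult_mono) auto
    then have "\<bar>2 * (v x - w x) * (F (\<sigma> x) - F (\<tau> x))\<bar> \<le> B * (2 * \<bar>\<sigma> x - \<tau> x\<bar> * \<bar>v x - w x\<bar>)"
      by (simp only: mult_ac)
    moreover have "\<bar>2 * (\<sigma> x - \<tau> x) * (v x - w x)\<bar> = 1 * (2 * \<bar>\<sigma> x - \<tau> x\<bar> * \<bar>v x - w x\<bar>)"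
      by (simp only: abs_mult abs_numeral mult_1)
    ultimately have "\<bar>u' x\<bar> \<le> (1 + B) * (2 * \<bar>\<sigma> x - \<tau> x\<bar> * \<bar>v x - w x\<bar>)"
      unfolding u'_def distrib_right
      by (intro abs_triangle_ineq[THEN order_trans] add_mono) linarith+
    also have "2 * \<bar>\<sigma> x - \<tau> x\<bar> * \<bar>v x - w x\<bar> \<le> u x"
      using sum_squares_bound[of "\<bar>\<sigma> x - \<tau> x\<bar>" "\<bar>v x - w x\<bar>"] by (simp add: u_def)
    finally show ?thesis using B(2) by simp
  qed
  have u0: "u t0 = 0" using init by (simp add: u_def)
  have "u t \<le> 0"
  proof (cases "t0 \<le> t")
    case True
    \<comment> \<open>The integrating factor turns the bound on \<open>u'\<close> into monotonicity
      starting from \<open>u t0 = 0\<close>. Backward in time the opposite sign of the exponent does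
      the same.\<close>
    have "u t * exp (- (1 + B) * (t - t0)) \<le> u t0 * exp (- (1 + B) * (t0 - t0))"
    proof (rule DERIV_nonpos_imp_nonincreasing[OF True])
      fix x assume "t0 \<le> x" "x \<le> t"
      then have x: "x \<in> ?S" by (simp add: closed_segment_eq_real_ivl)
      have "((\<lambda>x. u x * exp (- (1 + B) * (x - t0))) has_real_derivative
          (u' x - (1 + B) * u x) * exp (- (1 + B) * (x - t0))) (at x)"
        by (auto intro!: derivative_eq_intros u[OF x] simp: algebra_simps)
      moreover have "(u' x - (1 + B) * u x) * exp (- (1 + B) * (x - t0)) \<le> 0"
        using bound[OF x] by (intro mult_nonpos_nonneg) auto
      ultimately show "\<exists>y. ((\<lambda>x. u x * exp (- (1 + B) * (x - t0))) has_real_derivative y) (at x) \<and> y \<le> 0"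
        by blast
    qed
    then show ?thesis using u0 by (simp add: mult_le_0_iff)
  next
    case False
    then have "t \<le> t0" by simp
    then have "u t * exp ((1 + B) * (t - t0)) \<le> u t0 * exp ((1 + B) * (t0 - t0))"
    proof (rule DERIV_nonneg_imp_nondecreasing)
      fix x assume "t \<le> x" "x \<le> t0"
      then have x: "x \<in> ?S" by (simp add: closed_segment_eq_real_ivl)
      have "((\<lambda>x. u x * exp ((1 + B) * (x - t0))) has_real_derivative
          (u' x + (1 + B) * u x) * exp ((1 + B) * (x - t0))) (at x)"
        by (auto intro!: derivative_eq_intros u[OF x] simp: algebra_simps)
      moreover have "(u' x + (1 + B) * u x) * exp ((1 + B) * (x - t0)) \<ge> 0"
        using bound[OF x] by (intro mult_nonneg_nonneg) auto
      ultimately show "\<exists>y. ((\<lambda>x. u x * exp ((1 + B) * (x - t0))) has_real_derivative y) (at x) \<and> 0 \<le> y"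
        by blast
    qed
    then show ?thesis using u0 by (simp add: mult_le_0_iff)
  qed
  then show ?thesis unfolding u_def by (simp add: sum_power2_le_zero_iff)
qed

lemma potential_ode_global_solution:
  fixes V V1 V2 :: "real \<Rightarrow> real"
  assumes V: "\<And>x. (V has_real_derivative V1 x) (at x)"
      "\<And>x. (V1 has_real_derivative V2 x) (at x)"
    and J: "closed J" "convex J" "s0 \<in> J"
    and B: "\<And>x. x \<in> J \<Longrightarrow> \<bar>V2 x\<bar> \<le> B"
    and barrier: "\<And>x. x \<in> frontier J \<Longrightarrow> V x > v0\<^sup>2 + V s0"
  obtains \<sigma> v where "\<sigma> t0 = s0" "v t0 = v0"
    "\<And>t. (\<sigma> has_real_derivative v t) (at t)"
    "\<And>t. (v has_real_derivative - V1 (\<sigma> t) / 2) (at t)"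
proof -
  have B0: "B \<ge> 0" using B[OF J(3)] by linarith
  \<comment> \<open>Retracting the argument of \<open>V1\<close> to \<open>J\<close> makes the force globally Lipschitz; conservation of
    energy then keeps the solution inside \<open>J\<close>, where the force is unchanged.\<close>
  define r where "r = closest_point J"
  have r: "r x \<in> J" "\<bar>r x - r y\<bar> \<le> \<bar>x - y\<bar>" for x y
    using J closest_point_in_set[of J x] closest_point_lipschitz[of J x y]
    by (auto simp: r_def dist_real_def)
  have rJ: "r x = x" if "x \<in> J" for x using that by (simp add: r_def closest_point_self)
  have V1: "\<bar>V1 x - V1 y\<bar> \<le> B * \<bar>x - y\<bar>" if "x \<in> J" "y \<in> J" for x y
    using field_differentiable_bound[of J V1 V2 B x y] J V B that
    by (auto simp: abs_minus_commute intro: has_field_derivative_at_within)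
  define f where "f z = (snd z, - V1 (r (fst z)) / 2)" for z :: "real \<times> real"
  have V1r: "\<bar>V1 (r x) - V1 (r y)\<bar> \<le> B * \<bar>x - y\<bar>" for x y
    using V1[OF r(1) r(1), of x y] mult_left_mono[OF r(2) B0, of x y] by linarith
  have "(1 + B)-lipschitz_on UNIV f"
  proof (rule lipschitz_onI)
    fix x y :: "real \<times> real"
    have "dist (f x) (f y) \<le> \<bar>snd x - snd y\<bar> + \<bar>- V1 (r (fst x)) / 2 - (- V1 (r (fst y)) / 2)\<bar>"
      using norm_Pair_le[of "snd x - snd y" "- V1 (r (fst x)) / 2 - (- V1 (r (fst y)) / 2)"]
      by (simp add: f_def dist_norm)
    also have "\<bar>- V1 (r (fst x)) / 2 - (- V1 (r (fst y)) / 2)\<bar> \<le> B * \<bar>fst x - fst y\<bar>"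
      using V1r[of "fst x" "fst y"] by simp
    also have "\<bar>snd x - snd y\<bar> + B * \<bar>fst x - fst y\<bar> \<le> dist x y + B * dist x y"
      using dist_snd_le[of x y] dist_fst_le[of x y] B0
      by (intro add_mono mult_left_mono) (auto simp: dist_real_def)
    finally show "dist (f x) (f y) \<le> (1 + B) * dist x y" by (simp add: algebra_simps)
  qed (use B0 in simp)
  then obtain z where z0: "z t0 = (s0, v0)"
    and z: "\<And>t. (z has_vector_derivative f (z t)) (at t)"
    using lipschitz_ode_global_solution by metis
  define \<sigma> v where "\<sigma> t = fst (z t)" and "v t = snd (z t)" for t
  have \<sigma>: "(\<sigma> has_real_derivative v t) (at t)" for t
    using bounded_linear.has_vector_derivative[OF bounded_linear_fst z[of t]]
    unfolding has_real_derivative_iff_has_vector_derivative by (simp add: \<sigma>_def[abs_def] v_def f_def)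
  have v: "(v has_real_derivative - V1 (r (\<sigma> t)) / 2) (at t)" for t
    using bounded_linear.has_vector_derivative[OF bounded_linear_snd z[of t]]
    unfolding has_real_derivative_iff_has_vector_derivative by (simp add: \<sigma>_def v_def[abs_def] f_def)
  have "B-lipschitz_on UNIV (\<lambda>x. V1 (r x))"
    using V1r B0 by (auto intro!: lipschitz_onI simp: dist_real_def)
  \<comment> \<open>\<open>W\<close> is the potential of the retracted force. Its energy is
    conserved whether or not the solution stays in \<open>J\<close>, and \<open>W\<close> agrees
    with \<open>V\<close> on \<open>J\<close>.\<close>
  from continuous_has_antiderivative[OF lipschitz_on_continuous_on[OF this], of s0 "V s0"]
  obtain W where W0: "W s0 = V s0" and W: "\<And>x. (W has_real_derivative V1 (r x)) (at x)"
    unfolding has_real_derivative_iff_has_vector_derivative by metis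
  have "((\<lambda>t. (v t)\<^sup>2 + W (\<sigma> t)) has_real_derivative 0) (at t)" for t
    by (rule derivative_eq_intros v DERIV_chain2[OF W \<sigma>] refl | simp)+
  then have energy: "(v t)\<^sup>2 + W (\<sigma> t) = v0\<^sup>2 + V s0" for t
    using DERIV_isconst_all[of "\<lambda>t. (v t)\<^sup>2 + W (\<sigma> t)" t t0] z0 W0 by (simp add: \<sigma>_def v_def)
  have "\<exists>c. \<forall>x\<in>J. W x - V x = c"
  proof (rule has_field_derivative_zero_constant[OF J(2)])
    show "((\<lambda>x. W x - V x) has_real_derivative 0) (at x within J)" if "x \<in> J" for x
      using that by (auto intro!: derivative_eq_intros has_field_derivative_at_within[OF W]
          has_field_derivative_at_within[OF V(1)] simp: rJ)
  qed
  then have WV: "W x = V x" if "x \<in> J" for x using that J(3) W0 by (metis eq_iff_diff_eq_0)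
  \<comment> \<open>A connected trajectory that starts in \<open>J\<close> and leaves it meets the
    frontier. There \<open>W = V\<close> exceeds the total energy, although
    \<open>(v t)\<^sup>2\<close> is nonnegative.\<close>
  have "range \<sigma> \<subseteq> J"
  proof (rule ccontr)
    assume "\<not> range \<sigma> \<subseteq> J"
    moreover have "connected (range \<sigma>)"
      using \<sigma> by (intro connected_continuous_image continuous_at_imp_continuous_on ballI)
        (auto intro: DERIV_isCont)
    moreover have "\<sigma> t0 \<in> J" using z0 J by (simp add: \<sigma>_def)
    ultimately have "range \<sigma> \<inter> frontier J \<noteq> {}"
      by (intro connected_Int_frontier) blast+
    then obtain t where t: "\<sigma> t \<in> frontier J" by blast
    moreover from this have "\<sigma> t \<in> J" using J(1) frontier_subset_closed by blast
    ultimately have "v0\<^sup>2 + V s0 < W (\<sigma> t)" using barrier WV by simp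
    then show False using energy[of t] by (smt (verit) zero_le_power2)
  qed
  then have "r (\<sigma> t) = \<sigma> t" for t by (auto intro: rJ)
  then show thesis
    using that[of \<sigma> v] \<sigma> v z0 by (simp add: \<sigma>_def v_def)
qed

section \<open>The potential\<close>

text \<open>A family closed under differentiation: only \<open>A\<close> and \<open>B\<close>
  change. Besides the oscillating term of the potential it contains pure exponentials
  (\<open>b = 0\<close>) and constants (\<open>a = b = 0\<close>), hence all metric
  coefficients.\<close>

definition osc :: "real \<Rightarrow> real \<Rightarrow> real \<Rightarrow> real \<Rightarrow> real \<Rightarrow> real" where
  "osc a b A B s = exp (a * s) * (A * cos (b * s) + B * sin (b * s))"

lemma osc_has_derivative:
  "(osc a b A B has_real_derivative osc a b (a * A + b * B) (a * B - b * A) s) (at s)"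
  unfolding osc_def[abs_def] by (auto intro!: derivative_eq_intros simp: algebra_simps)

lemma abs_osc_le: "\<bar>osc a b A B s\<bar> \<le> exp (a * s) * (\<bar>A\<bar> + \<bar>B\<bar>)"
proof -
  have "\<bar>A * cos (b * s) + B * sin (b * s)\<bar> \<le> \<bar>A\<bar> * \<bar>cos (b * s)\<bar> + \<bar>B\<bar> * \<bar>sin (b * s)\<bar>"
    unfolding abs_mult[symmetric] by (rule abs_triangle_ineq)
  also have "\<dots> \<le> \<bar>A\<bar> * 1 + \<bar>B\<bar> * 1"
    by (intro add_mono mult_left_mono) auto
  finally show ?thesis by (simp add: osc_def abs_mult)
qed

text \<open>In amplitude-phase form the function is
  \<open>R * exp (a * s) * cos (b * s - \<phi>)\<close>. The cosine equals 1 at points arbitrarily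
  far to the left, where the exponential is large because \<open>a < 0\<close>.\<close>

lemma osc_unbounded_at_bot:
  assumes "a < 0" "b > 0" "(A, B) \<noteq> (0, 0)"
  shows "\<exists>s<s0. osc a b A B s > M"
proof -
  define R where "R = sqrt (A\<^sup>2 + B\<^sup>2)"
  have R: "R > 0" using assms(3) by (auto simp: R_def sum_power2_gt_zero_iff)
  obtain \<phi> where "Complex A B = rcis (cmod (Complex A B)) \<phi>"
    using rcis_cmod_Arg by metis
  then have AB: "A = R * cos \<phi>" "B = R * sin \<phi>"
    by (auto simp: R_def cmod_def complex_eq_iff)
  \<comment> \<open>Being below \<open>M / R / a\<close> with \<open>a < 0\<close> means
    \<open>a * s > M / R\<close>, and then \<open>exp x \<ge> 1 + x\<close> gives the required
    size.\<close>
  define L where "L = min s0 (M / R / a)"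
  obtain k :: nat where k: "(\<phi> - b * L) / (2 * pi) < k" using reals_Archimedean2 by blast
  define s where "s = (\<phi> - 2 * real k * pi) / b"
  have s: "s < L" using k \<open>b > 0\<close> by (simp add: s_def field_simps)
  have "A * cos (b * s) + B * sin (b * s) = R * cos (b * s - \<phi>)"
    by (simp add: AB cos_diff algebra_simps)
  also have "b * s - \<phi> = - (2 * real k * pi)" using \<open>b > 0\<close> by (simp add: s_def)
  also have "cos (- (2 * real k * pi)) = 1" by simp
  finally have "osc a b A B s = exp (a * s) * R" by (simp add: osc_def)
  moreover have "M / R < exp (a * s)"
  proof -
    have "a * s > a * (M / R / a)"
      using s \<open>a < 0\<close> by (intro mult_strict_left_mono_neg) (auto simp: L_def)
    then have "a * s > M / R" using \<open>a < 0\<close> by simp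
    then show ?thesis using exp_ge_add_one_self[of "a * s"] by linarith
  qed
  ultimately have "osc a b A B s > M" using R by (simp add: field_simps)
  then show ?thesis using s by (auto simp: L_def)
qed

lemma exp_unbounded_at_top:
  fixes c l :: real
  assumes "c > 0" "l > 0"
  shows "\<exists>s>s0. c * exp (l * s) > M"
proof -
  define s where "s = max (s0 + 1) (M / c / l)"
  have "l * s \<ge> l * (M / c / l)" using assms by (intro mult_left_mono) (auto simp: s_def)
  moreover have "l * (M / c / l) = M / c" using assms by simp
  ultimately have "exp (l * s) > M / c" using exp_ge_add_one_self[of "l * s"] by linarith
  then show ?thesis using assms by (intro exI[of _ s]) (auto simp: s_def field_simps)
qed

lemma exp_unbounded_at_bot:
  fixes c l :: real
  assumes "c > 0" "l < 0"
  shows "\<exists>s<s0. c * exp (l * s) > M"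
  using exp_unbounded_at_top[of c "- l" "- s0" M] assms
  by (metis minus_less_iff minus_mult_commute neg_0_less_iff_less)

text \<open>For a geodesic, \<open>a\<close> and \<open>b\<close> become \<open>2 * \<alpha>\<close>
  and \<open>2 * \<beta>\<close>, \<open>l i\<close> becomes \<open>2 * lam i\<close>, and
  \<open>c i\<close> is the square of a momentum.\<close>

locale exp_potential =
  fixes a b A B :: real and S :: "'i set" and c l :: "'i \<Rightarrow> real"
  assumes ab: "a \<le> 0" "b > 0" and S: "finite S" and c: "\<And>i. c i \<ge> 0"
begin

definition V :: "real \<Rightarrow> real" where
  "V s = osc a b A B s + (\<Sum>i\<in>S. c i * exp (l i * s))"

definition V1 :: "real \<Rightarrow> real" where
  "V1 s = osc a b (a * A + b * B) (a * B - b * A) s + (\<Sum>i\<in>S. c i * l i * exp (l i * s))"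

definition V2 :: "real \<Rightarrow> real" where
  "V2 s = osc a b (a * (a * A + b * B) + b * (a * B - b * A)) (a * (a * B - b * A) - b * (a * A + b * B)) s
    + (\<Sum>i\<in>S. c i * l i * l i * exp (l i * s))"

lemma V_deriv: "(V has_real_derivative V1 s) (at s)"
  unfolding V_def[abs_def] V1_def
  by (intro DERIV_add osc_has_derivative DERIV_sum) (auto intro!: derivative_eq_intros)

lemma V1_deriv: "(V1 has_real_derivative V2 s) (at s)"
  unfolding V1_def[abs_def] V2_def
  by (intro DERIV_add osc_has_derivative DERIV_sum) (auto intro!: derivative_eq_intros)

lemma V2_continuous: "continuous_on UNIV V2"
  unfolding V2_def[abs_def] osc_def by (intro continuous_intros)

lemma V_ge_term:
  assumes "i \<in> S"
  shows "V s \<ge> osc a b A B s + c i * exp (l i * s)"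
proof -
  have "c i * exp (l i * s) \<le> (\<Sum>i\<in>S. c i * exp (l i * s))"
    using S c assms by (intro member_le_sum) auto
  then show ?thesis by (simp add: V_def)
qed

text \<open>\<open>T\<close> is meant to be a half-line ending at \<open>s0\<close> along which no
  exponential with nonzero coefficient grows, so each one is dominated by its value at
  \<open>s0\<close>. Both directions use it.\<close>

lemma V2_bounded:
  assumes "\<And>s. s \<in> T \<Longrightarrow> \<bar>osc a b (a * (a * A + b * B) + b * (a * B - b * A))
        (a * (a * B - b * A) - b * (a * A + b * B)) s\<bar> \<le> K"
    and T: "\<And>i s. i \<in> S \<Longrightarrow> c i \<noteq> 0 \<Longrightarrow> s \<in> T \<Longrightarrow> l i * s \<le> l i * s0"
  shows "\<exists>K. \<forall>s\<in>T. \<bar>V2 s\<bar> \<le> K"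
proof (intro exI ballI)
  fix s assume s: "s \<in> T"
  have "\<bar>V2 s\<bar> \<le> K + \<bar>\<Sum>i\<in>S. c i * l i * l i * exp (l i * s)\<bar>"
    unfolding V2_def using assms(1)[OF s] by linarith
  also have "\<bar>\<Sum>i\<in>S. c i * l i * l i * exp (l i * s)\<bar> \<le> (\<Sum>i\<in>S. c i * (l i * l i) * exp (l i * s0))"
  proof (rule sum_abs[THEN order_trans], rule sum_mono)
    fix i assume "i \<in> S"
    then have "c i = 0 \<or> exp (l i * s) \<le> exp (l i * s0)" using T s by auto
    then have "c i * (l i * l i) * exp (l i * s) \<le> c i * (l i * l i) * exp (l i * s0)"
      using c[of i] by (metis mult_left_mono mult_nonneg_nonneg mult_zero_left order_refl zero_le_square)
    then show "\<bar>c i * l i * l i * exp (l i * s)\<bar> \<le> c i * (l i * l i) * exp (l i * s0)"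
      using c[of i] by (simp add: abs_mult mult.assoc)
  qed
  finally show "\<bar>V2 s\<bar> \<le> K + (\<Sum>i\<in>S. c i * (l i * l i) * exp (l i * s0))" by simp
qed

text \<open>
  On each side of \<open>s0\<close> either \<open>V\<close> exceeds \<open>E\<close> somewhere, which gives a barrier, or every
  growing term of \<open>V\<close> has coefficient zero, so that \<open>V2\<close> stays bounded.
\<close>

lemma right_barrier:
  "\<exists>R. closed R \<and> convex R \<and> {..s0} \<subseteq> R \<and> (\<forall>x\<in>frontier R. V x > E) \<and>
       (\<exists>K. \<forall>x\<in>R \<inter> {s0..}. \<bar>V2 x\<bar> \<le> K)"
proof (cases "\<exists>i\<in>S. c i \<noteq> 0 \<and> l i > 0")
  case True
  then obtain i where i: "i \<in> S" "c i > 0" "l i > 0" using c by (metis less_eq_real_def)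
  \<comment> \<open>Because \<open>a \<le> 0\<close>, \<open>K\<close> bounds the oscillating term
    everywhere to the right of \<open>s0\<close>, so a single growing exponential forces
    \<open>V\<close> above \<open>E\<close>.\<close>
  define K where "K = exp (a * s0) * (\<bar>A\<bar> + \<bar>B\<bar>)"
  obtain s where s: "s > s0" "c i * exp (l i * s) > E + K"
    using exp_unbounded_at_top[OF i(2,3)] by blast
  have "exp (a * s) * (\<bar>A\<bar> + \<bar>B\<bar>) \<le> K"
    unfolding K_def using s ab by (intro mult_right_mono) (auto intro: mult_left_mono_neg)
  then have "V s > E"
    using V_ge_term[OF i(1), of s] abs_osc_le[of a b A B s] s by linarith
  moreover have "bounded (V2 ` {s0..s})"
    using V2_continuous by (intro compact_imp_bounded compact_continuous_image)
      (auto intro: continuous_on_subset)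
  then have "\<exists>K. \<forall>x\<in>{..s} \<inter> {s0..}. \<bar>V2 x\<bar> \<le> K"
    unfolding bounded_iff by fastforce
  ultimately show ?thesis using s by (intro exI[of _ "{..s}"]) (auto simp: frontier_real_atMost frontier_real_atLeast)
next
  case False
  have "\<exists>K. \<forall>x\<in>{s0..}. \<bar>V2 x\<bar> \<le> K"
  proof (rule V2_bounded)
    fix s assume "s \<in> {s0..}"
    then show "\<bar>osc a b A' B' s\<bar> \<le> exp (a * s0) * (\<bar>A'\<bar> + \<bar>B'\<bar>)" for A' B'
      using ab by (intro order_trans[OF abs_osc_le] mult_right_mono) (auto intro: mult_left_mono_neg)
  next
    fix i s assume "i \<in> S" "c i \<noteq> 0" and s: "s \<in> {s0..}"
    then have "l i \<le> 0" using False by force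
    then show "l i * s \<le> l i * s0" using s by (auto intro: mult_left_mono_neg)
  qed
  then show ?thesis by (intro exI[of _ UNIV]) auto
qed

lemma left_barrier:
  "\<exists>R. closed R \<and> convex R \<and> {s0..} \<subseteq> R \<and> (\<forall>x\<in>frontier R. V x > E) \<and>
       (\<exists>K. \<forall>x\<in>R \<inter> {..s0}. \<bar>V2 x\<bar> \<le> K)"
proof (cases "\<exists>s<s0. V s > E")
  case True
  then obtain s where s: "s < s0" "V s > E" by blast
  have "bounded (V2 ` {s..s0})"
    using V2_continuous by (intro compact_imp_bounded compact_continuous_image)
      (auto intro: continuous_on_subset)
  then have "\<exists>K. \<forall>x\<in>{s..} \<inter> {..s0}. \<bar>V2 x\<bar> \<le> K"
    unfolding bounded_iff by fastforce
  then show ?thesis using s by (intro exI[of _ "{s..}"]) (auto simp: frontier_real_atMost frontier_real_atLeast)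
next
  case False
  \<comment> \<open>Otherwise the oscillating term would take arbitrarily high values to the left of
    \<open>s0\<close>, and the nonnegative exponentials cannot lower them.\<close>
  have a: "a = 0 \<or> A = 0 \<and> B = 0"
  proof (rule ccontr)
    assume "\<not> ?thesis"
    then obtain s where s: "s < s0" "osc a b A B s > E"
      using osc_unbounded_at_bot[of a b A B s0 E] ab by auto
    have "(\<Sum>i\<in>S. c i * exp (l i * s)) \<ge> 0" using c by (intro sum_nonneg) auto
    then show False using s False by (auto simp: V_def)
  qed
  have osc: "\<bar>osc a b A' B' s\<bar> \<le> \<bar>A'\<bar> + \<bar>B'\<bar>" if "a = 0 \<or> A' = 0 \<and> B' = 0" for A' B' s
    using that abs_osc_le[of a b A' B' s] by auto
  have "\<exists>K. \<forall>x\<in>{..s0}. \<bar>V2 x\<bar> \<le> K"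
  proof (rule V2_bounded)
    fix s
    show "\<bar>osc a b (a * (a * A + b * B) + b * (a * B - b * A)) (a * (a * B - b * A) - b * (a * A + b * B)) s\<bar>
      \<le> \<bar>a * (a * A + b * B) + b * (a * B - b * A)\<bar> + \<bar>a * (a * B - b * A) - b * (a * A + b * B)\<bar>"
      by (rule osc) (use a in auto)
  next
    fix i s assume i: "i \<in> S" "c i \<noteq> 0" and s: "s \<in> {..s0}"
    \<comment> \<open>Since the oscillating term is at least
      \<open>- (\<bar>A\<bar> + \<bar>B\<bar>)\<close>, an exponential growing to the left would
      again lift \<open>V\<close> above \<open>E\<close>.\<close>
    have "\<not> l i < 0"
    proof
      assume "l i < 0"
      then obtain x where "x < s0" "c i * exp (l i * x) > E + (\<bar>A\<bar> + \<bar>B\<bar>)"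
        using exp_unbounded_at_bot[of "c i" "l i"] c[of i] i by fastforce
      then show False
        using V_ge_term[OF i(1), of x] osc[OF a, of x] False by fastforce
    qed
    then show "l i * s \<le> l i * s0" using s by (auto intro: mult_left_mono)
  qed
  then show ?thesis by (intro exI[of _ UNIV]) auto
qed

text \<open>Intersecting the two one-sided sets works because the frontier of an intersection lies
  in the union of the frontiers, and each point lies on a side of \<open>s0\<close> where one of the
  bounds on \<open>V2\<close> holds.\<close>

lemma potential_well:
  obtains J K where "closed J" "convex J" "s0 \<in> J" "\<And>x. x \<in> frontier J \<Longrightarrow> V x > E"
    "\<And>x. x \<in> J \<Longrightarrow> \<bar>V2 x\<bar> \<le> K"
proof -
  obtain R K where R: "closed R" "convex R" "{..s0} \<subseteq> R" "\<And>x. x \<in> frontier R \<Longrightarrow> V x > E"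
    "\<And>x. x \<in> R \<inter> {s0..} \<Longrightarrow> \<bar>V2 x\<bar> \<le> K" using right_barrier[of s0 E] by blast
  obtain L K' where L: "closed L" "convex L" "{s0..} \<subseteq> L" "\<And>x. x \<in> frontier L \<Longrightarrow> V x > E"
    "\<And>x. x \<in> L \<inter> {..s0} \<Longrightarrow> \<bar>V2 x\<bar> \<le> K'" using left_barrier[of s0 E] by blast
  show thesis
  proof (rule that[of "L \<inter> R" "max K K'"])
    show "\<bar>V2 x\<bar> \<le> max K K'" if "x \<in> L \<inter> R" for x
      using R(5)[of x] L(5)[of x] that by (cases "x \<le> s0") auto
  qed (use R L frontier_Int_subset[of L R] in \<open>auto intro: convex_Int\<close>)
qed

end

section \<open>Expansions in the standard basis and smooth functions of the coordinates\<close>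

lemma linear_axis_expansion:
  fixes f :: "real ^ 'n::finite \<Rightarrow> real"
  assumes "linear f"
  shows "(\<Sum>i\<in>UNIV. v $ i * f (axis i 1)) = f v"
proof -
  have "f v = f (\<Sum>i\<in>UNIV. v $ i *\<^sub>R axis i 1)"
    using basis_expansion[of v] by (simp add: scalar_mult_eq_scaleR)
  then show ?thesis using assms by (simp add: linear_sum linear_cmul)
qed

lemma bilinear_axis_expansion:
  fixes f :: "real ^ 'n::finite \<Rightarrow> real ^ 'n \<Rightarrow> real"
  assumes "bilinear f"
  shows "(\<Sum>i\<in>UNIV. \<Sum>j\<in>UNIV. f (axis i 1) (axis j 1) * v $ i * w $ j) = f v w"
proof -
  have "(\<Sum>j\<in>UNIV. w $ j * f (axis i 1) (axis j 1)) = f (axis i 1) w" for i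
    using assms by (intro linear_axis_expansion) (simp add: bilinear_def)
  moreover have "(\<Sum>i\<in>UNIV. v $ i * f (axis i 1) w) = f v w"
    using assms by (intro linear_axis_expansion[of "\<lambda>v. f v w"]) (simp add: bilinear_def)
  ultimately show ?thesis
    by (simp add: sum_distrib_left mult_ac flip: \<open>_ = f v w\<close>) (simp add: mult_ac flip: sum_distrib_left)
qed

lemma partial_deriv_linear:
  assumes "linear f"
  shows "partial_deriv i (\<lambda>p. a + f p) p = f (axis i 1)"
proof -
  have "((\<lambda>p. a + f p) has_derivative f) (at p)"
    using assms by (auto intro!: derivative_eq_intros linear_imp_has_derivative)
  then show ?thesis by (simp add: partial_deriv_def flip: frechet_derivative_at)
qed

text \<open>The partial derivatives are constants, and those of constants vanish. This gives
  smoothness of the affine isometries and of their inverses.\<close>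

lemma smooth_affine:
  fixes f :: "real ^ 'n::finite \<Rightarrow> real"
  assumes "linear f"
  shows "smooth (\<lambda>p. a + f p)"
proof -
  have const: "Ck k (\<lambda>p::real ^ 'n. b)" for k b
  proof (induction k arbitrary: b)
    case (Suc k)
    have "partial_deriv i (\<lambda>p::real ^ 'n. b) = (\<lambda>p. 0)" for i
      using partial_deriv_linear[of "\<lambda>p. 0" i b] by (auto simp: linear_zero)
    then show ?case using Suc by simp
  qed simp
  have "Ck k (\<lambda>p. a + f p)" for k
  proof (cases k)
    case 0
    then show ?thesis
      using assms by (simp add: continuous_on_add linear_continuous_on linear_linear)
  next
    case (Suc k)
    have "(\<lambda>p. a + f p) differentiable (at p)" for p
      using assms linear_imp_differentiable[of f "at p"] by (auto intro!: derivative_intros)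
    moreover have "partial_deriv i (\<lambda>p. a + f p) = (\<lambda>p. f (axis i 1))" for i
      using assms by (auto simp: partial_deriv_linear)
    ultimately show ?thesis using Suc const by simp
  qed
  then show ?thesis by (simp add: smooth_def)
qed

lemma coordinate_function_has_derivative:
  assumes "(f has_real_derivative d) (at (p $ m))"
  shows "((\<lambda>p. f (p $ m)) has_derivative (\<lambda>h. d * h $ m)) (at p)"
  using has_derivative_compose[OF bounded_linear.has_derivative[OF bounded_linear_vec_nth has_derivative_ident]
      assms[unfolded has_field_derivative_def]] by simp

lemma partial_deriv_coordinate_function:
  fixes p :: "real ^ 'n::finite"
  assumes "(f has_real_derivative d) (at (p $ m))"
  shows "partial_deriv i (\<lambda>p. f (p $ m)) p = (if i = m then d else 0)"
  unfolding partial_deriv_def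
  using frechet_derivative_at[OF coordinate_function_has_derivative[OF assms], symmetric]
  by (auto simp: axis_def)

lemma smooth_osc_coordinate: "smooth (\<lambda>p::real ^ 'n::finite. osc a b A B (p $ m))"
proof -
  have "Ck k (\<lambda>p::real ^ 'n. osc a b A B (p $ m))" for k
  proof (induction k arbitrary: A B)
    case 0
    then show ?case by (auto simp: osc_def intro!: continuous_intros)
  next
    case (Suc k)
    \<comment> \<open>The vanishing partial derivatives are written as \<open>osc a b 0 0\<close>,
      so that the induction hypothesis, general in \<open>A\<close> and \<open>B\<close>, covers
      both branches.\<close>
    have "partial_deriv i (\<lambda>p. osc a b A B (p $ m)) =
        (\<lambda>p. if i = m then osc a b (a * A + b * B) (a * B - b * A) (p $ m) else osc a b 0 0 (p $ m))" for i
      by (rule ext, subst partial_deriv_coordinate_function[OF osc_has_derivative]) (simp add: osc_def)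
    then have "Ck k (partial_deriv i (\<lambda>p. osc a b A B (p $ m)))" for i
      using Suc by (cases "i = m") auto
    moreover have "(\<lambda>p. osc a b A B (p $ m)) differentiable (at p)" for p :: "real ^ 'n"
      using coordinate_function_has_derivative[OF osc_has_derivative] differentiable_def by blast
    ultimately show ?case by simp
  qed
  then show ?thesis by (simp add: smooth_def)
qed

section \<open>The metric and its isometries\<close>

locale rotating_metric =
  fixes e :: "nat \<Rightarrow> 'n::finite" and lam :: "nat \<Rightarrow> real" and \<alpha> \<beta> :: real
  assumes card: "CARD('n) \<ge> 4" and bij: "bij_betw e {1..CARD('n)} (UNIV :: 'n set)"
begin

lemma e_eq_iff [simp]: "i \<in> {1..CARD('n)} \<Longrightarrow> j \<in> {1..CARD('n)} \<Longrightarrow> e i = e j \<longleftrightarrow> i = j"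
  using bij unfolding bij_betw_def by (metis inj_on_eq_iff)

lemma e_cases: obtains i where "i \<in> {1..CARD('n)}" "k = e i"
  using bij by (metis UNIV_I bij_betw_def imageE)

definition mk :: "(nat \<Rightarrow> real) \<Rightarrow> real ^ 'n" where
  "mk f = (\<chi> k. f (the_inv_into {1..CARD('n)} e k))"

lemma mk_nth [simp]: "i \<in> {1..CARD('n)} \<Longrightarrow> mk f $ e i = f i"
  using bij by (simp add: mk_def bij_betw_def the_inv_into_f_f)

lemma axis_nth_e: "i \<in> {1..CARD('n)} \<Longrightarrow> j \<in> {1..CARD('n)} \<Longrightarrow> axis (e i) (x::real) $ e j = (if i = j then x else 0)"
  by (simp add: axis_def)

lemma vec_eqI: "(\<And>i. i \<in> {1..CARD('n)} \<Longrightarrow> v $ e i = w $ e i) \<Longrightarrow> v = (w :: real ^ 'n)"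
  unfolding vec_eq_iff by (metis e_cases)

lemma index_cases:
  assumes "i \<in> {1..CARD('n)}"
  obtains "i = 1" | "i = 2" | "i \<in> {3..CARD('n)-1}" | "i = CARD('n)"
  using assms by fastforce

text \<open>The metric as a one-parameter family of forms with parameter \<open>s\<close>, the value
  of \<open>x\<^sub>n\<close>; differentiating the metric becomes one-variable calculus.\<close>

definition H :: "real \<Rightarrow> real ^ 'n \<Rightarrow> real ^ 'n \<Rightarrow> real" where
  "H s v w =
     exp (- 2 * \<alpha> * s) *
       (cos (2 * \<beta> * s) * (- (v $ e 1 * w $ e 1) + v $ e 2 * w $ e 2)
        - sin (2 * \<beta> * s) * (v $ e 1 * w $ e 2 + v $ e 2 * w $ e 1))
     + (\<Sum>i\<in>{3..CARD('n)-1}. exp (- 2 * lam i * s) * (v $ e i * w $ e i))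
     + v $ e CARD('n) * w $ e CARD('n)"

lemma g_Rn_eq: "g_Rn e lam \<alpha> \<beta> p v w = H (p $ e CARD('n)) v w"
  by (simp add: g_Rn_def H_def Let_def)

text \<open>The derivative of \<open>H\<close> with respect to \<open>s\<close>, as
  \<open>H_has_derivative\<close> confirms.\<close>

definition D :: "real \<Rightarrow> real ^ 'n \<Rightarrow> real ^ 'n \<Rightarrow> real" where
  "D s v w =
     exp (- 2 * \<alpha> * s) *
       (- 2 * \<alpha> * (cos (2 * \<beta> * s) * (- (v $ e 1 * w $ e 1) + v $ e 2 * w $ e 2)
                - sin (2 * \<beta> * s) * (v $ e 1 * w $ e 2 + v $ e 2 * w $ e 1))
        - 2 * \<beta> * (sin (2 * \<beta> * s) * (- (v $ e 1 * w $ e 1) + v $ e 2 * w $ e 2)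
                + cos (2 * \<beta> * s) * (v $ e 1 * w $ e 2 + v $ e 2 * w $ e 1)))
     + (\<Sum>i\<in>{3..CARD('n)-1}. - 2 * lam i * exp (- 2 * lam i * s) * (v $ e i * w $ e i))"

lemma H_sym: "H s v w = H s w v" by (simp add: H_def mult_ac add_ac)
lemma D_sym: "D s v w = D s w v" by (simp add: D_def mult_ac add_ac)

lemma linear_H: "linear (H s v)"
  by (intro linearI) (simp_all add: H_def algebra_simps sum.distrib sum_distrib_left)

lemma linear_D: "linear (D s v)"
  by (intro linearI) (simp_all add: D_def algebra_simps sum.distrib sum_distrib_left sum_subtractf sum_negf)

lemma bilinear_H: "bilinear (H s)"
  unfolding bilinear_def using linear_H by (subst H_sym) auto

lemma bilinear_D: "bilinear (D s)"
  unfolding bilinear_def using linear_D by (subst D_sym) auto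

text \<open>The product rule. With \<open>v\<close> the velocity and \<open>w\<close> a coordinate
  vector it differentiates a momentum along a curve.\<close>

lemma H_has_derivative_along:
  assumes "(s has_real_derivative ds) (at t)" "(v has_vector_derivative a) (at t)"
  shows "((\<lambda>t. H (s t) (v t) w) has_real_derivative H (s t) a w + ds * D (s t) (v t) w) (at t)"
proof -
  have v: "((\<lambda>t. v t $ k) has_real_derivative a $ k) (at t)" for k
    using bounded_linear.has_vector_derivative[OF bounded_linear_vec_nth assms(2)]
    by (simp add: has_real_derivative_iff_has_vector_derivative)
  show ?thesis
    unfolding H_def D_def
    by (rule derivative_eq_intros v assms(1) refl)+
      (simp add: algebra_simps sum.distrib sum_distrib_left sum_subtractf sum_negf)
qed

lemma H_has_derivative: "((\<lambda>s. H s v w) has_real_derivative D s v w) (at s)"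
  using H_has_derivative_along[of "\<lambda>s. s" 1 s "\<lambda>s. v" 0 w] by (simp add: H_def)

text \<open>
  Completes \<open>x\<^sub>n \<mapsto> x\<^sub>n + c\<close> to an isometry. In the plane of \<open>x\<^sub>1, x\<^sub>2\<close> the metric at \<open>x\<^sub>n\<close> is a
  reflection form of angle \<open>2 * \<beta> * x\<^sub>n\<close>, which a rotation by \<open>\<beta> * c\<close> shifts by \<open>2 * \<beta> * c\<close>.
\<close>

definition boost :: "real \<Rightarrow> real ^ 'n \<Rightarrow> real ^ 'n" where
  "boost c v = mk (\<lambda>i. if i = 1 then exp (\<alpha> * c) * (cos (\<beta> * c) * v $ e 1 - sin (\<beta> * c) * v $ e 2)
     else if i = 2 then exp (\<alpha> * c) * (sin (\<beta> * c) * v $ e 1 + cos (\<beta> * c) * v $ e 2)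
     else if i = CARD('n) then v $ e CARD('n) else exp (lam i * c) * v $ e i)"

lemma boost_nth:
  "boost c v $ e (Suc 0) = exp (\<alpha> * c) * (cos (\<beta> * c) * v $ e 1 - sin (\<beta> * c) * v $ e 2)"
  "boost c v $ e 2 = exp (\<alpha> * c) * (sin (\<beta> * c) * v $ e 1 + cos (\<beta> * c) * v $ e 2)"
  "i \<in> {3..CARD('n)-1} \<Longrightarrow> boost c v $ e i = exp (lam i * c) * v $ e i"
  "boost c v $ e CARD('n) = v $ e CARD('n)"
  using card by (auto simp: boost_def)

lemma linear_boost: "linear (boost c)"
proof (rule linearI)
  fix x y :: "real ^ 'n" and r :: real
  show "boost c (x + y) = boost c x + boost c y"
    by (rule vec_eqI) (erule index_cases; simp add: boost_nth algebra_simps)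
  show "boost c (r *\<^sub>R x) = r *\<^sub>R boost c x"
    by (rule vec_eqI) (erule index_cases; simp add: boost_nth algebra_simps)
qed

text \<open>Changing the sign of \<open>c\<close> reverses the rotation and inverts every
  exponential scaling.\<close>

lemma boost_inverse [simp]: "boost (- c) (boost c v) = v"
proof (rule vec_eqI)
  fix i assume "i \<in> {1..CARD('n)}"
  have rot: "E' * (p * (E * (p * x - q * y)) + q * (E * (q * x + p * y))) = x"
      "E' * (p * (E * (q * x + p * y)) - q * (E * (p * x - q * y))) = y"
    if "E' * E = 1" "p\<^sup>2 + q\<^sup>2 = 1" for E E' p q x y :: real
  proof -
    have "E' * (p * (E * (p * x - q * y)) + q * (E * (q * x + p * y))) = (E' * E) * (p\<^sup>2 + q\<^sup>2) * x"
      "E' * (p * (E * (q * x + p * y)) - q * (E * (p * x - q * y))) = (E' * E) * (p\<^sup>2 + q\<^sup>2) * y"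
      by (simp_all add: power2_eq_square algebra_simps)
    then show "E' * (p * (E * (p * x - q * y)) + q * (E * (q * x + p * y))) = x"
      "E' * (p * (E * (q * x + p * y)) - q * (E * (p * x - q * y))) = y"
      using that by simp_all
  qed
  have exp: "exp (- x) * exp x = 1" for x :: real by (simp flip: exp_add)
  note rot = rot[of "exp (- (\<alpha> * c))" "exp (\<alpha> * c)" "cos (\<beta> * c)" "sin (\<beta> * c)" "v $ e 1" "v $ e 2",
      OF exp sin_cos_squared_add2]
  show "boost (- c) (boost c v) $ e i = v $ e i"
    using \<open>i \<in> {1..CARD('n)}\<close>
  proof (cases rule: index_cases)
    case 1
    then show ?thesis using rot(1) by (simp add: boost_nth)
  next
    case 2
    then show ?thesis using rot(2) by (simp add: boost_nth)
  next
    case 3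
    then show ?thesis by (simp add: boost_nth flip: mult.assoc exp_add)
  qed (simp add: boost_nth)
qed

lemma H_boost: "H (s + c) (boost c v) (boost c w) = H s v w"
proof -
  let ?p = "cos (\<beta> * c)" and ?q = "sin (\<beta> * c)"
  let ?C = "cos (2 * \<beta> * s)" and ?S = "sin (2 * \<beta> * s)"
  have pq: "?p\<^sup>2 + ?q\<^sup>2 = 1" by simp
  have arg: "2 * \<beta> * (s + c) = 2 * \<beta> * s + 2 * (\<beta> * c)" by (simp add: algebra_simps)
  have C: "cos (2 * \<beta> * (s + c)) = ?C * (?p\<^sup>2 - ?q\<^sup>2) - ?S * (2 * ?p * ?q)"
    unfolding arg cos_add cos_double sin_double by (simp add: mult.assoc)
  have S: "sin (2 * \<beta> * (s + c)) = ?S * (?p\<^sup>2 - ?q\<^sup>2) + ?C * (2 * ?p * ?q)"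
    unfolding arg sin_add cos_double sin_double by (simp add: mult.assoc)
  have rot: "(C * (p\<^sup>2 - q\<^sup>2) - S * (2 * p * q)) * (- ((p * v1 - q * v2) * (p * w1 - q * w2)) + (q * v1 + p * v2) * (q * w1 + p * w2))
      - (S * (p\<^sup>2 - q\<^sup>2) + C * (2 * p * q)) * ((p * v1 - q * v2) * (q * w1 + p * w2) + (q * v1 + p * v2) * (p * w1 - q * w2))
      = C * (- (v1 * w1) + v2 * w2) - S * (v1 * w2 + v2 * w1)"
    if "p\<^sup>2 + q\<^sup>2 = 1" for C S p q v1 v2 w1 w2 :: real
  proof -
    \<comment> \<open>Inserting the factor \<open>(p\<^sup>2 + q\<^sup>2)\<^sup>2 = 1\<close> makes
      the claim a polynomial identity.\<close>
    have "?thesis \<longleftrightarrow> (p\<^sup>2 + q\<^sup>2) * (p\<^sup>2 + q\<^sup>2) * (C * (- (v1 * w1) + v2 * w2) - S * (v1 * w2 + v2 * w1))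
        = C * (- (v1 * w1) + v2 * w2) - S * (v1 * w2 + v2 * w1)"
      by (simp add: power2_eq_square algebra_simps)
    then show ?thesis using that by simp
  qed
  \<comment> \<open>The scalings of the two arguments compensate the shift of \<open>s\<close> in
    the exponential coefficient.\<close>
  have e2: "exp (- 2 * x * (s + c)) * (exp (x * c) * y * (exp (x * c) * z)) = exp (- 2 * x * s) * (y * z)"
    for x y z :: real
  proof -
    have "exp (- 2 * x * (s + c)) * (exp (x * c) * exp (x * c)) = exp (- 2 * x * s)"
      by (simp add: algebra_simps flip: exp_add)
    then show ?thesis by (metis mult.assoc mult.left_commute)
  qed
  have "exp (- 2 * \<alpha> * (s + c)) * (C * (- ((exp (\<alpha> * c) * v1) * (exp (\<alpha> * c) * w1)) + (exp (\<alpha> * c) * v2) * (exp (\<alpha> * c) * w2))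
        - S * ((exp (\<alpha> * c) * v1) * (exp (\<alpha> * c) * w2) + (exp (\<alpha> * c) * v2) * (exp (\<alpha> * c) * w1)))
      = exp (- 2 * \<alpha> * s) * (C * (- (v1 * w1) + v2 * w2) - S * (v1 * w2 + v2 * w1))" for C S v1 v2 w1 w2
    using e2[of \<alpha> 1 "C * (- (v1 * w1) + v2 * w2) - S * (v1 * w2 + v2 * w1)"]
    by (simp add: algebra_simps)
  moreover have "(\<Sum>i\<in>{3..CARD('n)-1}. exp (- 2 * lam i * (s + c)) * (boost c v $ e i * boost c w $ e i))
      = (\<Sum>i\<in>{3..CARD('n)-1}. exp (- 2 * lam i * s) * (v $ e i * w $ e i))"
    by (intro sum.cong refl) (simp only: boost_nth e2)
  ultimately show ?thesis
    using rot[OF pq, of ?C ?S "v $ e 1" "v $ e 2" "w $ e 1" "w $ e 2"]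
    by (simp add: H_def boost_nth C S)
qed

lemma H_axis:
  "H s v (axis (e (Suc 0)) 1) = - (exp (- 2 * \<alpha> * s) * (cos (2 * \<beta> * s) * v $ e 1 + sin (2 * \<beta> * s) * v $ e 2))"
  "H s v (axis (e 2) 1) = exp (- 2 * \<alpha> * s) * (cos (2 * \<beta> * s) * v $ e 2 - sin (2 * \<beta> * s) * v $ e 1)"
  "i \<in> {3..CARD('n)-1} \<Longrightarrow> H s v (axis (e i) 1) = exp (- 2 * lam i * s) * v $ e i"
  "H s v (axis (e CARD('n)) 1) = v $ e CARD('n)"
proof -
  have *: "(\<Sum>i\<in>{3..CARD('n)-1}. f i * (v $ e i * axis (e a) 1 $ e i)) =
    (if a \<in> {3..CARD('n)-1} then f a * v $ e a else (0::real))" if "a \<in> {1..CARD('n)}" for a f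
  proof -
    have "(\<Sum>i\<in>{3..CARD('n)-1}. f i * (v $ e i * axis (e a) 1 $ e i)) =
        (\<Sum>i\<in>{3..CARD('n)-1}. if i = a then f a * v $ e a else 0)"
      using that by (intro sum.cong refl) (auto simp: axis_nth_e)
    then show ?thesis by simp
  qed
  have idx: "1 \<in> {1..CARD('n)}" "2 \<in> {1..CARD('n)}" "CARD('n) \<in> {1..CARD('n)}"
    using card by auto
  have gen: "H s v (axis (e a) 1) =
      exp (- 2 * \<alpha> * s) *
        (cos (2 * \<beta> * s) * (- (v $ e 1 * (if a = 1 then 1 else 0)) + v $ e 2 * (if a = 2 then 1 else 0))
         - sin (2 * \<beta> * s) * (v $ e 1 * (if a = 2 then 1 else 0) + v $ e 2 * (if a = 1 then 1 else 0)))
      + (if a \<in> {3..CARD('n)-1} then exp (- 2 * lam a * s) * v $ e a else 0)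
      + v $ e CARD('n) * (if a = CARD('n) then 1 else 0)" if "a \<in> {1..CARD('n)}" for a
    unfolding H_def by (simp only: *[OF that] axis_nth_e[OF that idx(1)] axis_nth_e[OF that idx(2)]
        axis_nth_e[OF that idx(3)])
  show "H s v (axis (e (Suc 0)) 1) = - (exp (- 2 * \<alpha> * s) * (cos (2 * \<beta> * s) * v $ e 1 + sin (2 * \<beta> * s) * v $ e 2))"
    using card gen[OF idx(1)] by (simp add: algebra_simps)
  show "H s v (axis (e 2) 1) = exp (- 2 * \<alpha> * s) * (cos (2 * \<beta> * s) * v $ e 2 - sin (2 * \<beta> * s) * v $ e 1)"
    using card gen[OF idx(2)] by (simp add: algebra_simps)
  show "i \<in> {3..CARD('n)-1} \<Longrightarrow> H s v (axis (e i) 1) = exp (- 2 * lam i * s) * v $ e i"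
    using card gen[of i] by auto
  show "H s v (axis (e CARD('n)) 1) = v $ e CARD('n)"
    using card gen[OF idx(3)] by auto
qed

text \<open>At \<open>s = 0\<close> the form is the standard Minkowski form. Nondegeneracy and the
  signature for other \<open>s\<close> are carried over from here by \<open>boost\<close>.\<close>

lemma H_zero_axis:
  assumes "i \<in> {1..CARD('n)}"
  shows "H 0 v (axis (e i) 1) = (if i = 1 then - v $ e 1 else v $ e i)"
  using assms
proof (cases rule: index_cases)
  case 1
  then show ?thesis by (simp add: H_axis(1))
next
  case 2
  then show ?thesis by (simp add: H_axis(2))
next
  case 3
  then show ?thesis using H_axis(3)[OF 3, of 0 v] by auto
next
  case 4
  then show ?thesis using card H_axis(4)[of 0 v] by auto
qed

text \<open>\<open>boost (- s)\<close> carries the form at \<open>s\<close> to the Minkowski form at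
  0, whose coordinate pairings detect every component.\<close>

lemma H_nondegenerate:
  assumes "\<And>w. H s v w = 0"
  shows "v = 0"
proof -
  let ?z = "boost (- s) v"
  have "H 0 ?z w = 0" for w
    using H_boost[of s "- s" v "boost s w"] assms by simp
  then have "?z = 0"
    using H_zero_axis[of _ ?z] by (intro vec_eqI) (metis neg_equal_0_iff_equal zero_index)
  then show ?thesis
    using boost_inverse[of "- s" v] linear_0[OF linear_boost] by simp
qed

lemma metric_coeff_eq:
  "metric_coeff (g_Rn e lam \<alpha> \<beta>) i j = (\<lambda>p. H (p $ e CARD('n)) (axis i 1) (axis j 1))"
  by (auto simp: metric_coeff_def g_Rn_eq)

lemma H_axis_eq_osc: "\<exists>a b A B. \<forall>s. H s v (axis j 1) = osc a b A B s"
proof -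
  obtain k where k: "k \<in> {1..CARD('n)}" "j = e k" by (rule e_cases)
  from k(1) show ?thesis
  proof (cases rule: index_cases)
    case 1
    have "H s v (axis (e 1) 1) = osc (- 2 * \<alpha>) (2 * \<beta>) (- v $ e 1) (- v $ e 2) s" for s
      by (simp add: H_axis(1) osc_def algebra_simps)
    with k 1 show ?thesis by blast
  next
    case 2
    have "H s v (axis (e 2) 1) = osc (- 2 * \<alpha>) (2 * \<beta>) (v $ e 2) (- v $ e 1) s" for s
      by (simp add: H_axis(2) osc_def algebra_simps)
    with k 2 show ?thesis by blast
  next
    case 3
    then have "H s v (axis (e k) 1) = osc (- 2 * lam k) 0 (v $ e k) 0 s" for s
      by (simp add: H_axis(3) osc_def)
    with k show ?thesis by blast
  next
    case 4
    have "H s v (axis (e CARD('n)) 1) = osc 0 0 (v $ e CARD('n)) 0 s" for s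
      by (simp add: H_axis(4) osc_def)
    with k 4 show ?thesis by blast
  qed
qed

lemma smooth_metric_coeff: "smooth (metric_coeff (g_Rn e lam \<alpha> \<beta>) i j)"
proof -
  obtain a b A B where "\<And>s. H s (axis i 1) (axis j 1) = osc a b A B s"
    using H_axis_eq_osc by blast
  then show ?thesis by (simp add: metric_coeff_eq smooth_osc_coordinate)
qed

text \<open>Since \<open>boost s\<close> carries the form at 0 to the form at \<open>s\<close>, the
  images of the coordinate vectors are an orthonormal frame, with that of
  \<open>axis (e 1) 1\<close> timelike.\<close>

lemma lorentzian_g_Rn: "lorentzian_metric (g_Rn e lam \<alpha> \<beta>)"
proof -
  have frame: "H s (boost s (axis i 1)) (boost s (axis j 1)) = (if i \<noteq> j then 0 else if i = e 1 then - 1 else 1)"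
    for s i j
  proof -
    obtain k where k: "k \<in> {1..CARD('n)}" "j = e k" by (rule e_cases)
    have "H s (boost s (axis i 1)) (boost s (axis j 1)) = H 0 (axis i 1) (axis j 1)"
      using H_boost[of 0 s] by simp
    also have "\<dots> = (if k = 1 then - axis i 1 $ e 1 else axis i 1 $ e k)"
      using k by (simp only: H_zero_axis)
    also have "\<dots> = (if i \<noteq> j then 0 else if i = e 1 then - 1 else 1)"
      using k card e_eq_iff[of k 1] by (simp add: axis_def)
    finally show ?thesis .
  qed
  show ?thesis
    unfolding lorentzian_metric_def
  proof (intro conjI allI)
    fix p :: "real ^ 'n"
    show "bilinear (g_Rn e lam \<alpha> \<beta> p)"
      using bilinear_H[of "p $ e CARD('n)"] by (simp add: bilinear_def g_Rn_eq)
    show "\<exists>(b :: 'n \<Rightarrow> real ^ 'n) k. \<forall>i j. g_Rn e lam \<alpha> \<beta> p (b i) (b j) = (if i \<noteq> j then 0 else if i = k then - 1 else 1)"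
      unfolding g_Rn_eq
      by (intro exI[of _ "\<lambda>i. boost (p $ e CARD('n)) (axis i 1)"] exI[of _ "e 1"] allI frame)
    show "g_Rn e lam \<alpha> \<beta> p v w = g_Rn e lam \<alpha> \<beta> p w v" for v w
      unfolding g_Rn_eq by (rule H_sym)
  qed (rule smooth_metric_coeff)
qed

text \<open>The affine map with linear part \<open>boost c\<close> taking \<open>p\<close> to
  \<open>q\<close> is an isometry when \<open>c\<close> is the difference of their last coordinates,
  since it then shifts \<open>x\<^sub>n\<close> by exactly \<open>c\<close>.\<close>

lemma homogeneous_g_Rn: "homogeneous (g_Rn e lam \<alpha> \<beta>)"
  unfolding homogeneous_def
proof (intro allI)
  fix p q :: "real ^ 'n"
  define c where "c = q $ e CARD('n) - p $ e CARD('n)"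
  define \<phi> where "\<phi> x = q + boost c (x - p)" for x
  define \<psi> where "\<psi> y = p + boost (- c) (y - q)" for y
  have inv: "\<psi> (\<phi> x) = x" "\<phi> (\<psi> x) = x" for x
    using boost_inverse[of "- c"] by (simp_all add: \<phi>_def \<psi>_def)
  have smooth: "smooth (\<lambda>x. (a + boost c (x - b)) $ i)" for a b c i
  proof -
    have "linear (\<lambda>x. boost c x $ i)"
      using linear_compose[OF linear_boost bounded_linear.linear[OF bounded_linear_vec_nth]]
      by (simp add: o_def)
    from smooth_affine[OF this, of "(a - boost c b) $ i"] show ?thesis
      by (simp add: linear_diff[OF linear_boost] algebra_simps)
  qed
  have "bij \<phi>" by (rule o_bij[of \<psi>]) (auto simp: inv)
  moreover have "inv \<phi> = \<psi>" using inv by (intro inv_equality) auto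
  ultimately have "diffeomorphism \<phi>"
    using smooth by (auto simp: diffeomorphism_def \<phi>_def \<psi>_def)
  moreover have "frechet_derivative \<phi> (at x) = boost c" for x
  proof -
    have "(\<phi> has_derivative (\<lambda>h. boost c (h - 0))) (at x)"
      unfolding \<phi>_def
      by (rule derivative_eq_intros has_derivative_compose[of "\<lambda>x. x - p"] refl
          linear_imp_has_derivative linear_boost | simp)+
    then show ?thesis by (simp flip: frechet_derivative_at)
  qed
  moreover have "g_Rn e lam \<alpha> \<beta> (\<phi> x) (boost c v) (boost c w) = g_Rn e lam \<alpha> \<beta> x v w" for x v w
  proof -
    have "\<phi> x $ e CARD('n) = x $ e CARD('n) + c"
      by (simp add: \<phi>_def boost_nth c_def)
    then show ?thesis by (simp add: g_Rn_eq H_boost)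
  qed
  moreover have "\<phi> p = q" by (simp add: \<phi>_def linear_0[OF linear_boost])
  ultimately show "\<exists>\<phi>. isometry (g_Rn e lam \<alpha> \<beta>) \<phi> \<and> \<phi> p = q"
    unfolding isometry_def by metis
qed

section \<open>Geodesics\<close>

lemma partial_deriv_metric_coeff:
  "partial_deriv i (metric_coeff (g_Rn e lam \<alpha> \<beta>) j l) p =
     (if i = e CARD('n) then D (p $ e CARD('n)) (axis j 1) (axis l 1) else 0)"
  unfolding metric_coeff_eq by (rule partial_deriv_coordinate_function[OF H_has_derivative])

abbreviation metric_matrix :: "real ^ 'n \<Rightarrow> real ^ 'n ^ 'n" where
  "metric_matrix p \<equiv> (\<chi> a b. metric_coeff (g_Rn e lam \<alpha> \<beta>) a b p)"

lemma metric_matrix_mult: "(metric_matrix p *v v) $ l = H (p $ e CARD('n)) v (axis l 1)"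
proof -
  have "(\<Sum>b\<in>UNIV. v $ b * H (p $ e CARD('n)) (axis l 1) (axis b 1)) = H (p $ e CARD('n)) (axis l 1) v"
    by (rule linear_axis_expansion[OF linear_H])
  then show ?thesis
    by (simp add: matrix_vector_mult_def metric_coeff_eq mult.commute H_sym[of _ v])
qed

lemma H_eqI:
  assumes "\<And>l. H s v (axis l 1) = H s w (axis l 1)"
  shows "v = w"
proof -
  have "H s (v - w) u = 0" for u
  proof -
    have *: "H s x u = (\<Sum>l\<in>UNIV. u $ l * H s x (axis l 1))" for x
      by (rule linear_axis_expansion[OF linear_H, symmetric])
    have "H s v u = H s w u" by (simp add: *[of v] *[of w] assms)
    then show ?thesis
      using linear_diff[OF linear_H, of s u v w] by (simp add: H_sym[of s _ u])
  qed
  then show ?thesis using H_nondegenerate by fastforce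
qed

text \<open>Nondegeneracy makes the kernel trivial, hence the matrix invertible; only then does the
  choice behind \<open>matrix_inv\<close> yield an actual inverse.\<close>

lemma matrix_inv_metric_matrix:
  "matrix_inv (metric_matrix p) ** metric_matrix p = mat 1"
  "metric_matrix p ** matrix_inv (metric_matrix p) = mat 1"
proof -
  have "metric_matrix p *v v = 0 \<longrightarrow> v = 0" for v
  proof
    assume "metric_matrix p *v v = 0"
    then have "H (p $ e CARD('n)) v (axis l 1) = H (p $ e CARD('n)) 0 (axis l 1)" for l
      using metric_matrix_mult[of p v l] by (simp add: H_def)
    then show "v = 0" by (rule H_eqI)
  qed
  then have "invertible (metric_matrix p)"
    unfolding invertible_left_inverse matrix_left_invertible_ker by blast
  from someI_ex[OF this[unfolded invertible_def]]
  show "matrix_inv (metric_matrix p) ** metric_matrix p = mat 1"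
    "metric_matrix p ** matrix_inv (metric_matrix p) = mat 1"
    unfolding matrix_inv_def by blast+
qed

text \<open>Lowering the free index with the invertible metric matrix gives the Euler-Lagrange form:
  the rate of change of the momentum in direction \<open>l\<close> is half the \<open>l\<close>-th
  partial derivative of the metric on \<open>u, u\<close>, which vanishes except for
  \<open>x\<^sub>n\<close>.\<close>

lemma geodesic_equation_iff:
  defines "g \<equiv> g_Rn e lam \<alpha> \<beta>"
  shows "(\<forall>k. a $ k + (\<Sum>i\<in>UNIV. \<Sum>j\<in>UNIV. christoffel g k i j p * u $ i * u $ j) = 0) \<longleftrightarrow>
    (\<forall>l. H (p $ e CARD('n)) a (axis l 1) + u $ e CARD('n) * D (p $ e CARD('n)) u (axis l 1)
       = (if l = e CARD('n) then D (p $ e CARD('n)) u u / 2 else 0))"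
proof -
  let ?s = "p $ e CARD('n)" and ?M = "metric_matrix p"
  \<comment> \<open>The Christoffel symbols of the first kind contracted twice with
    \<open>u\<close>.\<close>
  define y :: "real ^ 'n" where
    "y = (\<chi> l. u $ e CARD('n) * D ?s u (axis l 1) - (if l = e CARD('n) then D ?s u u / 2 else 0))"
  have expand: "(\<Sum>i\<in>UNIV. \<Sum>j\<in>UNIV. (partial_deriv i (metric_coeff g j l) p
         + partial_deriv j (metric_coeff g i l) p
         - partial_deriv l (metric_coeff g i j) p) * u $ i * u $ j) = 2 * y $ l" for l
  proof -
    have lin: "(\<Sum>j\<in>UNIV. u $ j * D ?s (axis j 1) (axis l 1)) = D ?s u (axis l 1)"
      using linear_axis_expansion[OF linear_D, of u ?s "axis l 1"] by (simp add: D_sym[of _ "axis l 1"])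
    have "(\<Sum>i\<in>UNIV. \<Sum>j\<in>UNIV. partial_deriv i (metric_coeff g j l) p * u $ i * u $ j)
        = u $ e CARD('n) * D ?s u (axis l 1)" (is "?A = _")
    proof -
      have "?A = (\<Sum>i\<in>UNIV. if i = e CARD('n) then u $ i * D ?s u (axis l 1) else 0)"
        by (intro sum.cong refl)
          (simp add: g_def partial_deriv_metric_coeff mult_ac flip: lin sum_distrib_left)
      then show ?thesis by simp
    qed
    moreover from this have "(\<Sum>i\<in>UNIV. \<Sum>j\<in>UNIV. partial_deriv j (metric_coeff g i l) p * u $ i * u $ j)
        = u $ e CARD('n) * D ?s u (axis l 1)"
      by (subst sum.swap) (simp add: mult_ac)
    moreover have "(\<Sum>i\<in>UNIV. \<Sum>j\<in>UNIV. partial_deriv l (metric_coeff g i j) p * u $ i * u $ j)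
        = (if l = e CARD('n) then D ?s u u else 0)"
      using bilinear_axis_expansion[OF bilinear_D, of ?s u u]
      by (simp add: g_def partial_deriv_metric_coeff)
    ultimately show ?thesis
      by (simp add: y_def algebra_simps sum.distrib sum_subtractf)
  qed
  have "(\<Sum>i\<in>UNIV. \<Sum>j\<in>UNIV. christoffel g k i j p * u $ i * u $ j) = (matrix_inv ?M *v y) $ k" for k
  proof -
    have "(\<Sum>i\<in>UNIV. \<Sum>j\<in>UNIV. christoffel g k i j p * u $ i * u $ j) =
       (\<Sum>i\<in>UNIV. \<Sum>j\<in>UNIV. \<Sum>l\<in>UNIV. matrix_inv ?M $ k $ l / 2 * ((partial_deriv i (metric_coeff g j l) p
         + partial_deriv j (metric_coeff g i l) p
         - partial_deriv l (metric_coeff g i j) p) * u $ i * u $ j))"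
      unfolding christoffel_def g_def[symmetric]
      by (simp add: sum_distrib_left sum_distrib_right mult_ac)
    also have "\<dots> = (\<Sum>l\<in>UNIV. matrix_inv ?M $ k $ l / 2 * (\<Sum>i\<in>UNIV. \<Sum>j\<in>UNIV. (partial_deriv i (metric_coeff g j l) p
         + partial_deriv j (metric_coeff g i l) p
         - partial_deriv l (metric_coeff g i j) p) * u $ i * u $ j))"
      unfolding sum_distrib_left by (rule trans[OF sum.cong[OF refl sum.swap] sum.swap])
    finally show ?thesis by (simp add: expand matrix_vector_mult_def)
  qed
  then have "(\<forall>k. a $ k + (\<Sum>i\<in>UNIV. \<Sum>j\<in>UNIV. christoffel g k i j p * u $ i * u $ j) = 0) \<longleftrightarrow>
      a + matrix_inv ?M *v y = 0"
    by (simp add: vec_eq_iff)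
  also have "\<dots> \<longleftrightarrow> ?M *v a + y = 0"
  proof
    assume "a + matrix_inv ?M *v y = 0"
    then have "?M *v (a + matrix_inv ?M *v y) = 0" by simp
    then show "?M *v a + y = 0"
      by (simp add: matrix_vector_right_distrib matrix_vector_mul_assoc matrix_inv_metric_matrix)
  next
    assume "?M *v a + y = 0"
    then have "matrix_inv ?M *v (?M *v a + y) = 0" by simp
    then show "a + matrix_inv ?M *v y = 0"
      by (simp add: matrix_vector_right_distrib matrix_vector_mul_assoc matrix_inv_metric_matrix)
  qed
  also have "\<dots> \<longleftrightarrow> (\<forall>l. (?M *v a) $ l + y $ l = 0)"
    by (simp add: vec_eq_iff)
  also have "\<dots> \<longleftrightarrow> (\<forall>l. H ?s a (axis l 1) + u $ e CARD('n) * D ?s u (axis l 1)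
       = (if l = e CARD('n) then D ?s u u / 2 else 0))"
    unfolding metric_matrix_mult by (auto simp: y_def)
  finally show ?thesis .
qed

section \<open>Velocities expressed through momenta\<close>

lemma mk_eq_sum: "mk f = (\<Sum>i\<in>{1..CARD('n)}. f i *\<^sub>R axis (e i) 1)"
proof (rule vec_eqI)
  fix k assume k: "k \<in> {1..CARD('n)}"
  have "(\<Sum>i\<in>{1..CARD('n)}. f i *\<^sub>R axis (e i) 1) $ e k = (\<Sum>i\<in>{1..CARD('n)}. if i = k then f i else 0)"
    unfolding sum_component using k by (intro sum.cong refl) (auto simp: axis_nth_e)
  then show "mk f $ e k = (\<Sum>i\<in>{1..CARD('n)}. f i *\<^sub>R axis (e i) 1) $ e k"
    using k by simp
qed

lemma mk_has_vector_derivative: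
  assumes "\<And>i. i \<in> {1..CARD('n)} \<Longrightarrow> (f i has_real_derivative f' i) (at t)"
  shows "((\<lambda>t. mk (\<lambda>i. f i t)) has_vector_derivative mk f') (at t)"
  unfolding mk_eq_sum
proof (rule has_vector_derivative_sum)
  fix i assume "i \<in> {1..CARD('n)}"
  from has_vector_derivative_scaleR[OF assms[OF this] has_vector_derivative_const]
  show "((\<lambda>t. f i t *\<^sub>R axis (e i) 1) has_vector_derivative f' i *\<^sub>R axis (e i) 1) (at t)"
    by simp
qed

text \<open>
  The vector with momenta \<open>p $ l\<close> in the directions \<open>l \<noteq> e n\<close>
  and vanishing last coordinate.
\<close>

definition sharp :: "real ^ 'n \<Rightarrow> real \<Rightarrow> real ^ 'n" where
  "sharp p s = mk (\<lambda>i. if i = 1 then osc (2 * \<alpha>) (2 * \<beta>) (- p $ e 1) (- p $ e 2) s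
     else if i = 2 then osc (2 * \<alpha>) (2 * \<beta>) (p $ e 2) (- p $ e 1) s
     else if i = CARD('n) then 0 else osc (2 * lam i) 0 (p $ e i) 0 s)"

lemma sharp_nth:
  "sharp p s $ e (Suc 0) = osc (2 * \<alpha>) (2 * \<beta>) (- p $ e 1) (- p $ e 2) s"
  "sharp p s $ e 2 = osc (2 * \<alpha>) (2 * \<beta>) (p $ e 2) (- p $ e 1) s"
  "i \<in> {3..CARD('n)-1} \<Longrightarrow> sharp p s $ e i = osc (2 * lam i) 0 (p $ e i) 0 s"
  "sharp p s $ e CARD('n) = 0"
  using card by (auto simp: sharp_def)

lemma sharp_differentiable: "\<exists>d. (sharp p has_vector_derivative d) (at s)"
proof -
  define f where "f i s = (if i = 1 then osc (2 * \<alpha>) (2 * \<beta>) (- p $ e 1) (- p $ e 2) s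
     else if i = 2 then osc (2 * \<alpha>) (2 * \<beta>) (p $ e 2) (- p $ e 1) s
     else if i = CARD('n) then 0 else osc (2 * lam i) 0 (p $ e i) 0 s)" for i s
  have d: "\<exists>d. (osc a b A B has_real_derivative d) (at s)" "\<exists>d. ((\<lambda>s. 0) has_real_derivative d) (at s)"
    for a b A B
    using osc_has_derivative DERIV_const by blast+
  have "\<exists>d. (f i has_real_derivative d) (at s)" for i
    unfolding f_def[abs_def]
    by (cases "i = 1"; cases "i = 2"; cases "i = CARD('n)") (simp_all del: One_nat_def add: d)
  then obtain f' where "\<And>i. (f i has_real_derivative f' i) (at s)" by metis
  then have "((\<lambda>s. mk (\<lambda>i. f i s)) has_vector_derivative mk f') (at s)"
    by (intro mk_has_vector_derivative)
  then show ?thesis unfolding sharp_def[abs_def] f_def by blast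
qed

lemma axis_last_nth:
  "axis (e CARD('n)) (1::real) $ e (Suc 0) = 0"
  "axis (e CARD('n)) (1::real) $ e 2 = 0"
  "i \<in> {3..CARD('n)-1} \<Longrightarrow> axis (e CARD('n)) (1::real) $ e i = 0"
  "axis (e CARD('n)) (1::real) $ e CARD('n) = 1"
  using axis_nth_e[of "CARD('n)"] card by auto

lemma D_axis_last: "D s v (axis (e CARD('n)) 1) = 0"
  by (simp add: D_def axis_last_nth)

lemma exp_cancel: "exp (- (x::real)) * (exp x * y) = y"
  by (simp flip: mult.assoc exp_add)

text \<open>In the plane of \<open>x\<^sub>1, x\<^sub>2\<close> the metric matrix is
  \<open>exp (- 2 * \<alpha> * s)\<close> times a reflection. A reflection is its own inverse, so
  \<open>sharp\<close> applies the same reflection with the reciprocal factor.\<close>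

lemma H_sharp:
  "H s (sharp p s + x *\<^sub>R axis (e CARD('n)) 1) (axis l 1) = (if l = e CARD('n) then x else p $ l)"
proof -
  obtain k where k: "k \<in> {1..CARD('n)}" "l = e k" by (rule e_cases)
  have l: "l = e CARD('n) \<longleftrightarrow> k = CARD('n)" using k card by (simp del: One_nat_def)
  let ?C = "cos (2 * \<beta> * s)" and ?S = "sin (2 * \<beta> * s)"
  have rot: "E' * (C * (E * (b * C - a * S)) - S * (E * (- a * C - b * S))) = b"
      "E' * (C * (E * (- a * C - b * S)) + S * (E * (b * C - a * S))) = - a"
    if "E' * E = 1" "C\<^sup>2 + S\<^sup>2 = 1" for E E' C S a b :: real
  proof -
    have "E' * (C * (E * (b * C - a * S)) - S * (E * (- a * C - b * S))) = (E' * E) * (C\<^sup>2 + S\<^sup>2) * b"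
      "E' * (C * (E * (- a * C - b * S)) + S * (E * (b * C - a * S))) = (E' * E) * (C\<^sup>2 + S\<^sup>2) * - a"
      by (simp_all add: power2_eq_square algebra_simps)
    then show "E' * (C * (E * (b * C - a * S)) - S * (E * (- a * C - b * S))) = b"
      "E' * (C * (E * (- a * C - b * S)) + S * (E * (b * C - a * S))) = - a"
      using that by simp_all
  qed
  have exp: "exp (- (2 * \<alpha> * s)) * exp (2 * \<alpha> * s) = 1" by (simp flip: exp_add)
  note rot = rot[OF exp sin_cos_squared_add2[of "2 * \<beta> * s"], where a = "p $ e 1" and b = "p $ e 2"]
  from k(1) show ?thesis
  proof (cases rule: index_cases)
    case 1
    then show ?thesis using rot(2) k l card
      by (simp add: H_axis(1) sharp_nth axis_last_nth osc_def)
  next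
    case 2
    then show ?thesis using rot(1) k l card
      by (simp add: H_axis(2) sharp_nth axis_last_nth osc_def)
  next
    case 3
    then have "k \<noteq> CARD('n)" using card by auto
    then show ?thesis using k l exp_cancel[of "2 * lam k * s"]
      by (simp only: H_axis(3)[OF 3] vector_add_component vector_scaleR_component sharp_nth(3)[OF 3]
          axis_last_nth(3)[OF 3]) (simp add: osc_def)
  next
    case 4
    then show ?thesis using k by (simp add: H_axis(4) sharp_nth axis_last_nth)
  qed
qed

text \<open>The potential is the inverse metric evaluated on the fixed momenta. Differentiating an
  inverse matrix produces a minus sign, so the derivative of the metric on the velocity is minus the
  derivative of the potential.\<close>

lemma D_sharp:
  fixes p s
  defines "A \<equiv> (p $ e 2)\<^sup>2 - (p $ e 1)\<^sup>2" and "B \<equiv> - 2 * p $ e 1 * p $ e 2"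
  shows "D s (sharp p s + x *\<^sub>R axis (e CARD('n)) 1) (sharp p s + x *\<^sub>R axis (e CARD('n)) 1) =
    - (osc (2 * \<alpha>) (2 * \<beta>) (2 * \<alpha> * A + 2 * \<beta> * B) (2 * \<alpha> * B - 2 * \<beta> * A) s
       + (\<Sum>i\<in>{3..CARD('n)-1}. (p $ e i)\<^sup>2 * (2 * lam i) * exp (2 * lam i * s)))"
proof -
  let ?u = "sharp p s + x *\<^sub>R axis (e CARD('n)) 1"
  have plane: "E' * (- 2 * \<alpha> * (C * (- (u1 * u1) + u2 * u2) - S * (u1 * u2 + u2 * u1))
        - 2 * \<beta> * (S * (- (u1 * u1) + u2 * u2) + C * (u1 * u2 + u2 * u1)))
      = - (E * ((2 * \<alpha> * (p2\<^sup>2 - p1\<^sup>2) + 2 * \<beta> * (- 2 * p1 * p2)) * C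
            + (2 * \<alpha> * (- 2 * p1 * p2) - 2 * \<beta> * (p2\<^sup>2 - p1\<^sup>2)) * S))"
    if "E' * E = 1" "C\<^sup>2 + S\<^sup>2 = 1" "u1 = E * (- p1 * C + - p2 * S)" "u2 = E * (p2 * C + - p1 * S)"
    for E E' C S p1 p2 u1 u2 :: real
  proof -
    have 1: "C * (- (u1 * u1) + u2 * u2) - S * (u1 * u2 + u2 * u1)
        = E * E * (C\<^sup>2 + S\<^sup>2) * ((p2\<^sup>2 - p1\<^sup>2) * C + (- 2 * p1 * p2) * S)"
      unfolding that(3,4) by (simp add: power2_eq_square algebra_simps)
    have 2: "S * (- (u1 * u1) + u2 * u2) + C * (u1 * u2 + u2 * u1)
        = E * E * (C\<^sup>2 + S\<^sup>2) * ((- 2 * p1 * p2) * C - (p2\<^sup>2 - p1\<^sup>2) * S)"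
      unfolding that(3,4) by (simp add: power2_eq_square algebra_simps)
    have "E' * (- 2 * \<alpha> * (C * (- (u1 * u1) + u2 * u2) - S * (u1 * u2 + u2 * u1))
        - 2 * \<beta> * (S * (- (u1 * u1) + u2 * u2) + C * (u1 * u2 + u2 * u1)))
      = - ((E' * E) * ((C\<^sup>2 + S\<^sup>2) * (E * ((2 * \<alpha> * (p2\<^sup>2 - p1\<^sup>2) + 2 * \<beta> * (- 2 * p1 * p2)) * C
            + (2 * \<alpha> * (- 2 * p1 * p2) - 2 * \<beta> * (p2\<^sup>2 - p1\<^sup>2)) * S))))"
      unfolding 1 2 by (simp add: algebra_simps)
    then show ?thesis unfolding that(1,2) mult_1_left .
  qed
  have "exp (- 2 * \<alpha> * s) * exp (2 * \<alpha> * s) = 1" by (simp flip: exp_add)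
  note plane = plane[OF this sin_cos_squared_add2, of "?u $ e 1" "p $ e 1" "2 * \<beta> * s" "p $ e 2" "?u $ e 2"]
  have "(\<Sum>i\<in>{3..CARD('n)-1}. - 2 * lam i * exp (- 2 * lam i * s) * (?u $ e i * ?u $ e i))
      = (\<Sum>i\<in>{3..CARD('n)-1}. - ((p $ e i)\<^sup>2 * (2 * lam i) * exp (2 * lam i * s)))"
  proof (intro sum.cong refl)
    fix i assume i: "i \<in> {3..CARD('n)-1}"
    have "- 2 * lam i * exp (- 2 * lam i * s) * ((exp (2 * lam i * s) * y) * (exp (2 * lam i * s) * y))
        = - (y\<^sup>2 * (2 * lam i) * (exp (- (2 * lam i * s)) * (exp (2 * lam i * s) * exp (2 * lam i * s))))" for y
      by (simp add: power2_eq_square mult_ac)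
    then show "- 2 * lam i * exp (- 2 * lam i * s) * (?u $ e i * ?u $ e i)
        = - ((p $ e i)\<^sup>2 * (2 * lam i) * exp (2 * lam i * s))"
      unfolding exp_cancel by (simp add: sharp_nth(3)[OF i] axis_last_nth(3)[OF i] osc_def)
  qed
  moreover have "?u $ e 1 = exp (2 * \<alpha> * s) * (- p $ e 1 * cos (2 * \<beta> * s) + - p $ e 2 * sin (2 * \<beta> * s))"
    "?u $ e 2 = exp (2 * \<alpha> * s) * (p $ e 2 * cos (2 * \<beta> * s) + - p $ e 1 * sin (2 * \<beta> * s))"
    by (simp_all add: sharp_nth axis_last_nth osc_def)
  ultimately show ?thesis
    unfolding D_def plane[OF \<open>?u $ e 1 = _\<close> \<open>?u $ e 2 = _\<close>] by (simp only: osc_def A_def B_def sum_negf minus_add_distrib)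
qed

section \<open>Extension of geodesics to all times\<close>

lemma geodesically_complete_g_Rn:
  assumes "\<alpha> \<le> 0" "\<beta> > 0"
  shows "geodesically_complete (g_Rn e lam \<alpha> \<beta>)"
  unfolding geodesically_complete_def
proof (intro allI impI, elim conjE)
  fix I \<gamma>
  assume I: "open I" "is_interval I" "I \<noteq> {}" and geo: "geodesic_on (g_Rn e lam \<alpha> \<beta>) I \<gamma>"
  let ?n = "e CARD('n)"
  define s where "s t = \<gamma> t $ ?n" for t
  from geo obtain \<gamma>' \<gamma>'' where \<gamma>: "\<And>t. t \<in> I \<Longrightarrow> (\<gamma> has_vector_derivative \<gamma>' t) (at t)"
    and \<gamma>': "\<And>t. t \<in> I \<Longrightarrow> (\<gamma>' has_vector_derivative \<gamma>'' t) (at t)"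
    and eq: "\<And>t l. t \<in> I \<Longrightarrow> H (s t) (\<gamma>'' t) (axis l 1) + \<gamma>' t $ ?n * D (s t) (\<gamma>' t) (axis l 1)
       = (if l = ?n then D (s t) (\<gamma>' t) (\<gamma>' t) / 2 else 0)"
    unfolding geodesic_on_def geodesic_equation_iff s_def by metis
  have nth: "((\<lambda>t. f t $ k) has_real_derivative d $ k) (at t)"
    if "(f has_vector_derivative d) (at t)" for f :: "real \<Rightarrow> real ^ 'n" and d t k
    using bounded_linear.has_vector_derivative[OF bounded_linear_vec_nth that]
    by (simp add: has_real_derivative_iff_has_vector_derivative)
  have s: "(s has_real_derivative \<gamma>' t $ ?n) (at t)" if "t \<in> I" for t
    unfolding s_def[abs_def] by (rule nth[OF \<gamma>[OF that]])
  obtain t0 where t0: "t0 \<in> I" using I by blast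
  have convex: "convex I" using I by (simp add: is_interval_convex)
  define p :: "real ^ 'n" where "p = (\<chi> l. H (s t0) (\<gamma>' t0) (axis l 1))"
  have momentum: "H (s t) (\<gamma>' t) (axis l 1) = p $ l" if t: "t \<in> I" and l: "l \<noteq> ?n" for t l
  proof -
    have "((\<lambda>t. H (s t) (\<gamma>' t) (axis l 1)) has_real_derivative 0) (at t within I)" if "t \<in> I" for t
      using H_has_derivative_along[OF s[OF that] \<gamma>'[OF that], of "axis l 1"] eq[OF that, of l] l
      by (auto intro: has_field_derivative_at_within)
    from has_field_derivative_zero_constant[OF convex this]
    show ?thesis using t t0 by (auto simp: p_def)
  qed
  \<comment> \<open>By nondegeneracy the velocity is determined by the conserved momenta, the
    position \<open>s t\<close> and its own last component.\<close>
  have \<gamma>'_eq: "\<gamma>' t = sharp p (s t) + \<gamma>' t $ ?n *\<^sub>R axis ?n 1" if "t \<in> I" for t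
    by (rule H_eqI[of "s t"]) (simp only: H_sharp momentum[OF that] H_axis(4) split: if_split, simp add: H_axis(4) momentum[OF that])
  interpret W: exp_potential "2 * \<alpha>" "2 * \<beta>" "(p $ e 2)\<^sup>2 - (p $ e 1)\<^sup>2" "- 2 * p $ e 1 * p $ e 2"
    "{3..CARD('n)-1}" "\<lambda>i. (p $ e i)\<^sup>2" "\<lambda>i. 2 * lam i"
    using assms by unfold_locales auto
  have D_sharp': "D r (sharp p r + x *\<^sub>R axis ?n 1) (sharp p r + x *\<^sub>R axis ?n 1) = - W.V1 r" for r x
    unfolding W.V1_def by (rule D_sharp)
  \<comment> \<open>The remaining component of the geodesic equation is a one-dimensional Newton
    equation for \<open>s\<close>, decoupled from the other coordinates.\<close>
  have s': "((\<lambda>t. \<gamma>' t $ ?n) has_real_derivative - W.V1 (s t) / 2) (at t)" if "t \<in> I" for t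
  proof -
    have "\<gamma>'' t $ ?n = D (s t) (\<gamma>' t) (\<gamma>' t) / 2"
      using eq[OF that, of ?n] by (simp add: H_axis(4) D_axis_last)
    also have "D (s t) (\<gamma>' t) (\<gamma>' t) = - W.V1 (s t)"
      using D_sharp'[of "s t" "\<gamma>' t $ ?n"] unfolding \<gamma>'_eq[OF that, symmetric] .
    finally show ?thesis using nth[OF \<gamma>'[OF that], of ?n] by simp
  qed
  obtain J K where J: "closed J" "convex J" "s t0 \<in> J"
    "\<And>x. x \<in> frontier J \<Longrightarrow> W.V x > (\<gamma>' t0 $ ?n)\<^sup>2 + W.V (s t0)"
    "\<And>x. x \<in> J \<Longrightarrow> \<bar>W.V2 x\<bar> \<le> K"
    using W.potential_well by blast
  obtain \<sigma> v where init: "\<sigma> t0 = s t0" "v t0 = \<gamma>' t0 $ ?n"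
    and \<sigma>: "\<And>t. (\<sigma> has_real_derivative v t) (at t)"
    and v: "\<And>t. (v has_real_derivative - W.V1 (\<sigma> t) / 2) (at t)"
    by (rule potential_ode_global_solution[OF W.V_deriv W.V1_deriv J(1-3) J(5) J(4)]) blast+
  \<comment> \<open>Uniqueness identifies the global solution with the last coordinate of the given
    geodesic on \<open>I\<close>, the only place where the latter satisfies the equation.\<close>
  have \<sigma>_eq: "\<sigma> t = s t" if "t \<in> I" for t
  proof (rule second_order_ode_unique[OF I(2) t0 that \<sigma> v s s'])
    show "((\<lambda>x. - W.V1 x / 2) has_real_derivative - W.V2 x / 2) (at x)" for x
      by (rule DERIV_cdivide[OF DERIV_minus[OF W.V1_deriv]])
    show "continuous_on UNIV (\<lambda>x. - W.V2 x / 2)"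
      by (intro continuous_intros W.V2_continuous) auto
  qed (use init in auto)
  have v_eq: "v t = \<gamma>' t $ ?n" if "t \<in> I" for t
  proof (rule DERIV_unique[OF \<sigma>])
    show "(\<sigma> has_real_derivative \<gamma>' t $ ?n) (at t)"
      by (rule has_field_derivative_transform_within_open[OF s[OF that] I(1) that]) (simp add: \<sigma>_eq)
  qed
  \<comment> \<open>The extension is built from its velocity, prescribed by the momenta and by
    \<open>\<sigma>\<close>, and then integrated from \<open>\<gamma> t0\<close>.\<close>
  define \<delta>' where "\<delta>' t = sharp p (\<sigma> t) + v t *\<^sub>R axis ?n 1" for t
  have "\<exists>d. (\<delta>' has_vector_derivative d) (at t)" for t
  proof -
    obtain d where d: "(sharp p has_vector_derivative d) (at (\<sigma> t))" using sharp_differentiable by blast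
    have "(\<sigma> has_vector_derivative v t) (at t)"
      using \<sigma> by (simp add: has_real_derivative_iff_has_vector_derivative)
    from vector_diff_chain_at[OF this d]
    have "((\<lambda>t. sharp p (\<sigma> t)) has_vector_derivative v t *\<^sub>R d) (at t)" by (simp add: o_def)
    from has_vector_derivative_add[OF this has_vector_derivative_scaleR[OF v has_vector_derivative_const]]
    show ?thesis unfolding \<delta>'_def[abs_def] by blast
  qed
  then obtain \<delta>'' where \<delta>': "\<And>t. (\<delta>' has_vector_derivative \<delta>'' t) (at t)" by metis
  then have "continuous_on UNIV \<delta>'"
    by (intro continuous_at_imp_continuous_on ballI has_vector_derivative_continuous)
  then obtain \<delta> where \<delta>0: "\<delta> t0 = \<gamma> t0" and \<delta>: "\<And>t. (\<delta> has_vector_derivative \<delta>' t) (at t)"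
    by (rule continuous_has_antiderivative) blast
  have \<delta>'n: "\<delta>' t $ ?n = v t" for t by (simp add: \<delta>'_def sharp_nth axis_last_nth)
  \<comment> \<open>The metric along \<open>\<delta>\<close> is evaluated at its own last
    coordinate, so this must be shown to be \<open>\<sigma>\<close> before the geodesic equation can
    be checked.\<close>
  have \<delta>n: "\<delta> t $ ?n = \<sigma> t" for t
  proof -
    have "((\<lambda>t. \<delta> t $ ?n - \<sigma> t) has_real_derivative 0) (at t)" for t
      using DERIV_diff[OF nth[OF \<delta>, of ?n] \<sigma>] by (simp add: \<delta>'n)
    then have "\<delta> t $ ?n - \<sigma> t = \<delta> t0 $ ?n - \<sigma> t0"
      using DERIV_isconst_all by blast
    then show ?thesis by (simp add: \<delta>0 init s_def)
  qed
  have "H (\<sigma> t) (\<delta>'' t) (axis l 1) + v t * D (\<sigma> t) (\<delta>' t) (axis l 1)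
       = (if l = ?n then D (\<sigma> t) (\<delta>' t) (\<delta>' t) / 2 else 0)" for t l
  proof (cases "l = ?n")
    case True
    have "((\<lambda>t. \<delta>' t $ ?n) has_real_derivative \<delta>'' t $ ?n) (at t)" by (rule nth[OF \<delta>'])
    then have "(v has_real_derivative \<delta>'' t $ ?n) (at t)" by (simp add: \<delta>'n)
    then have "\<delta>'' t $ ?n = - W.V1 (\<sigma> t) / 2" by (rule DERIV_unique[OF _ v])
    then show ?thesis
      using True by (simp add: H_axis(4) D_axis_last \<delta>'_def D_sharp')
  next
    case False
    \<comment> \<open>The left-hand side of the equation is the derivative of a momentum, which is
      the constant \<open>p $ l\<close> by construction of \<open>\<delta>'\<close>.\<close>
    have "((\<lambda>t. H (\<sigma> t) (\<delta>' t) (axis l 1)) has_real_derivative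
        H (\<sigma> t) (\<delta>'' t) (axis l 1) + v t * D (\<sigma> t) (\<delta>' t) (axis l 1)) (at t)"
      by (rule H_has_derivative_along[OF \<sigma> \<delta>'])
    moreover have "(\<lambda>t. H (\<sigma> t) (\<delta>' t) (axis l 1)) = (\<lambda>t. p $ l)"
      using False by (simp add: \<delta>'_def H_sharp)
    ultimately show ?thesis
      using DERIV_unique[OF DERIV_const] False by auto
  qed
  then have "geodesic_on (g_Rn e lam \<alpha> \<beta>) UNIV \<delta>"
    unfolding geodesic_on_def geodesic_equation_iff \<delta>n \<delta>'n[symmetric]
    using \<delta> \<delta>' by blast
  moreover have "\<delta> t = \<gamma> t" if "t \<in> I" for t
  proof -
    \<comment> \<open>On \<open>I\<close> both curves have the same velocity, and they agree at
      \<open>t0\<close>.\<close>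
    have "((\<lambda>t. \<delta> t - \<gamma> t) has_vector_derivative 0) (at t within I)" if "t \<in> I" for t
      using has_vector_derivative_diff[OF \<delta> \<gamma>[OF that]] \<gamma>'_eq[OF that] \<sigma>_eq[OF that] v_eq[OF that]
      by (simp add: \<delta>'_def has_vector_derivative_at_within)
    from has_vector_derivative_zero_constant[OF convex this]
    obtain c where "\<And>t. t \<in> I \<Longrightarrow> \<delta> t - \<gamma> t = c" by blast
    then show ?thesis using \<delta>0 t0 that by (metis eq_iff_diff_eq_0)
  qed
  ultimately show "\<exists>\<delta>. geodesic_on (g_Rn e lam \<alpha> \<beta>) UNIV \<delta> \<and> (\<forall>t\<in>I. \<delta> t = \<gamma> t)"
    by blast
qed

end

theorem proposition5p1:
  fixes e :: "nat \<Rightarrow> 'n::finite"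
    and lam :: "nat \<Rightarrow> real"
    and \<alpha> \<beta> :: real
  assumes "CARD('n) \<ge> 4"
    and "bij_betw e {1..CARD('n)} (UNIV :: 'n set)"
    and "\<alpha> \<le> 0"
    and "\<beta> > 0"
  shows "lorentzian_metric (g_Rn e lam \<alpha> \<beta>) \<and>
         homogeneous (g_Rn e lam \<alpha> \<beta>) \<and>
         geodesically_complete (g_Rn e lam \<alpha> \<beta>)"
proof -
  interpret rotating_metric e lam \<alpha> \<beta>
    using assms by unfold_locales
  show ?thesis
    using lorentzian_g_Rn homogeneous_g_Rn geodesically_complete_g_Rn assms by blast
qed

end
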